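(* Let $\mathbb V$ be a Schubert representation of $\widehat H_n$ with generic Schubert classes $\{\mathcal Y_w\}$ and equivariant parameters $t_1,\dots,t_n$, and let $f\in\mathcal A_\hbar[x_1,\dots,x_n]$ be symmetric in $x_1,\dots,x_k$ and symmetric in $x_{k+1},\dots,x_n$. (i) For each $\mu\subseteq(n-k)^k$ there are $P_{\lambda,\mu}\in\mathcal A_\hbar[x_1,\dots,x_n]$ with $$\overline T_\mu f=\sum_{\lambda\subseteq(n-k)^k}P_{\lambda,\mu}(x_1,\dots,x_n)\,\overline T_\lambda.$$ (ii) With these $P_{\lambda,\mu}$, for each $\lambda\subseteq(n-k)^k$, $$f\cdot\mathcal Y_\lambda=\sum_{\mu\subseteq(n-k)^k}P_{\lambda,\mu}(t_1,\dots,t_n)\,\mathcal Y_\mu.$$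
   Context: $\mathcal A_\hbar=\mathbb Q[p,q,\hbar]$; $\widehat H_n$ is the $\mathcal A_\hbar$-algebra generated by $T_1,\dots,T_{n-1},x_1,\dots,x_n$ with relations $(T_i+p)(T_i-q)=0$, $T_iT_j=T_jT_i$ ($|i-j|>1$), $T_iT_{i+1}T_i=T_{i+1}T_iT_{i+1}$, $x_ix_j=x_jx_i$, $T_ix_j=x_jT_i$ ($j\ne i,i+1$), $T_ix_i=x_{i+1}T_i+(\hbar-(p-q)x_i)$, $T_ix_{i+1}=x_iT_i-(\hbar-(p-q)x_i)$. $T_w,\overline T_w$ are defined via reduced words, with $\overline T_i=T_i+p-q$. Schubert representation: field $\mathbb F$, $t_1,\dots,t_n\in\mathbb F$, ring map $\mathcal A_\hbar\to\mathbb F$, $\mathbb F$-space $\mathbb V$ with $\widehat H_n$-action (scalars of $\mathcal A_\hbar$ via $\mathbb F$), basis $\mathcal Y_w=T_{w^{-1}w_0}\cdot\mathcal Y_{w_0}$, and $\mathbb F$-linear $\operatorname{ev}$ with $\operatorname{ev}(\mathcal Y_w)\ne0\iff w=\mathrm{id}$ and $\operatorname{ev}(x_i\mathcal Y_w)=t_i\operatorname{ev}(\mathcal Y_w)$. Partitions $\lambda\subseteq(n-k)^k$: $n-k\ge\lambda_1\ge\dots\ge\lambda_k\ge0$; $w_\lambda\in S_n$ with $w_\lambda(k+1-i)=\lambda_i+k+1-i$ ($1\le i\le k$), increasing on $\{k+1,\dots,n\}$; every $w\in S_n$ factors uniquely as $w=w_\lambda v$ with $v\in S_k\times S_{n-k}$,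 and we write $\operatorname{Gr}(w)=\lambda$. Quantum numbers $[m]=(p^m-q^m)/(p-q)$, $[m]!=[m][m-1]\cdots[1]$, $[0]!=1$; $d=\binom k2+\binom{n-k}2$. Define $\Sigma^n_k=\frac1{[k]![n-k]!}\sum_{v\in S_k\times S_{n-k}}q^{d-\ell(v)}\overline T_v$ (scalars extended so that $[k]![n-k]!$ is invertible), $\overline T_\lambda=\overline T_{w_\lambda}\Sigma^n_k$, and $\mathcal Y_\lambda=\sum_{v\in S_k\times S_{n-k}}p^{\ell(v)}\mathcal Y_{w_\lambda v}$. $P(t_1,\dots,t_n)$ means the image in $\mathbb F$ under $x_i\mapsto t_i$. *)

theory Defs
  imports Complex_Main "HOL-Library.Poly_Mapping" "HOL-Combinatorics.Permutations" "HOL-Combinatorics.Transposition"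
begin

text \<open>Generators: Gp, Gq, Gh are the scalars p, q, hbar of A_hbar = Q[p,q,hbar];
  GT i is T_i (1 <= i <= n-1), GX i is x_i (1 <= i <= n); Gc is the adjoined inverse of
  [k]![n-k]! (used only for the localized algebra in which Sigma^n_k lives).\<close>
datatype gen = Gp | Gq | Gh | GT nat | GX nat | Gc

text \<open>Free associative Q-algebra on the generators: finitely supported functions on words.\<close>
type_synonym fa = "gen list \<Rightarrow>\<^sub>0 rat"

definition fmul :: "fa \<Rightarrow> fa \<Rightarrow> fa" where
  "fmul a b = (\<Sum>u\<in>Poly_Mapping.keys a. \<Sum>w\<in>Poly_Mapping.keys b. Poly_Mapping.single (u @ w) (Poly_Mapping.lookup a u * Poly_Mapping.lookup b w))"

definition fconst :: "rat \<Rightarrow> fa" where "fconst r = Poly_Mapping.single [] r"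
definition fone :: fa where "fone = fconst 1"
definition fgen :: "gen \<Rightarrow> fa" where "fgen g = Poly_Mapping.single [g] 1"
definition fprod :: "fa list \<Rightarrow> fa" where "fprod xs = foldr fmul xs fone"
definition fpow :: "gen \<Rightarrow> nat \<Rightarrow> fa" where "fpow g j = fprod (replicate j (fgen g))"
definition fcomm :: "fa \<Rightarrow> fa \<Rightarrow> fa" where "fcomm a b = fmul a b - fmul b a"

inductive_set fideal :: "fa set \<Rightarrow> fa set" for R :: "fa set" where
  gen: "r \<in> R \<Longrightarrow> fmul (fmul a r) b \<in> fideal R"
| zero: "0 \<in> fideal R"
| add: "a \<in> fideal R \<Longrightarrow> b \<in> fideal R \<Longrightarrow> a + b \<in> fideal R"

definition heq :: "fa set \<Rightarrow> fa \<Rightarrow> fa \<Rightarrow> bool" where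
  "heq R a b \<longleftrightarrow> a - b \<in> fideal R"

definition scal_gen :: "gen \<Rightarrow> bool" where
  "scal_gen g \<longleftrightarrow> g = Gp \<or> g = Gq \<or> g = Gh"

text \<open>Relators of \<open>\<widehat>H_n\<close> over A_hbar (as a Q-algebra with central p,q,hbar).
  Generators out of range are killed, so the quotient is exactly \<open>\<widehat>H_n\<close>.\<close>
definition hrel :: "nat \<Rightarrow> fa set" where
  "hrel n =
     {fcomm (fgen s) (fgen g) | s g. scal_gen s}
   \<union> {fgen (GT i) | i. i = 0 \<or> n \<le> i}
   \<union> {fgen (GX i) | i. i = 0 \<or> n < i}
   \<union> {fgen Gc}
   \<union> {fmul (fgen (GT i) + fgen Gp) (fgen (GT i) - fgen Gq) | i. 1 \<le> i \<and> i < n}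
   \<union> {fcomm (fgen (GT i)) (fgen (GT j)) | i j. 1 \<le> i \<and> i < n \<and> 1 \<le> j \<and> j < n \<and> Suc i < j}
   \<union> {fprod [fgen (GT i), fgen (GT (Suc i)), fgen (GT i)]
        - fprod [fgen (GT (Suc i)), fgen (GT i), fgen (GT (Suc i))] | i. 1 \<le> i \<and> Suc i < n}
   \<union> {fcomm (fgen (GX i)) (fgen (GX j)) | i j. 1 \<le> i \<and> i \<le> n \<and> 1 \<le> j \<and> j \<le> n}
   \<union> {fcomm (fgen (GT i)) (fgen (GX j)) | i j. 1 \<le> i \<and> i < n \<and> 1 \<le> j \<and> j \<le> n \<and> j \<noteq> i \<and> j \<noteq> Suc i}
   \<union> {fmul (fgen (GT i)) (fgen (GX i))
        - (fmul (fgen (GX (Suc i))) (fgen (GT i))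
           + (fgen Gh - fmul (fgen Gp - fgen Gq) (fgen (GX i)))) | i. 1 \<le> i \<and> i < n}
   \<union> {fmul (fgen (GT i)) (fgen (GX (Suc i)))
        - (fmul (fgen (GX i)) (fgen (GT i))
           - (fgen Gh - fmul (fgen Gp - fgen Gq) (fgen (GX i)))) | i. 1 \<le> i \<and> i < n}"

text \<open>Quantum numbers [m] = (p^m - q^m)/(p-q) = sum_{j<m} p^j q^(m-1-j), and [m]!.\<close>
definition fqnum :: "nat \<Rightarrow> fa" where
  "fqnum m = (\<Sum>j<m. fmul (fpow Gp j) (fpow Gq (m - 1 - j)))"
definition fqfact :: "nat \<Rightarrow> fa" where
  "fqfact m = fprod (map fqnum (rev [1..<Suc m]))"

text \<open>Scalar extension A_hbar[1/([k]![n-k]!)]: Gc is a central inverse of [k]![n-k]!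
  (instead of being killed).\<close>
definition hrel_loc :: "nat \<Rightarrow> nat \<Rightarrow> fa set" where
  "hrel_loc n k = (hrel n - {fgen Gc})
     \<union> {fcomm (fgen Gc) (fgen g) | g. True}
     \<union> {fmul (fgen Gc) (fmul (fqfact k) (fqfact (n - k))) - fone}"

definition Sn :: "nat \<Rightarrow> (nat \<Rightarrow> nat) set" where
  "Sn n = {w. w permutes {1..n}}"

definition young :: "nat \<Rightarrow> nat \<Rightarrow> (nat \<Rightarrow> nat) set" where
  "young n k = {v. v permutes {1..n} \<and> v ` {1..k} = {1..k}}"

definition plen :: "nat \<Rightarrow> (nat \<Rightarrow> nat) \<Rightarrow> nat" where
  "plen n w = card {(i, j). 1 \<le> i \<and> i < j \<and> j \<le> n \<and> w j < w i}"

definition w0 :: "nat \<Rightarrow> nat \<Rightarrow> nat" where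
  "w0 n i = (if 1 \<le> i \<and> i \<le> n then n + 1 - i else i)"

definition sprod :: "nat list \<Rightarrow> nat \<Rightarrow> nat" where
  "sprod ws = foldr (\<lambda>i acc. transpose i (Suc i) \<circ> acc) ws id"

definition red_word :: "nat \<Rightarrow> (nat \<Rightarrow> nat) \<Rightarrow> nat list \<Rightarrow> bool" where
  "red_word n w ws \<longleftrightarrow> (\<forall>i\<in>set ws. 1 \<le> i \<and> i < n) \<and> sprod ws = w \<and> length ws = plen n w"

definition rword :: "nat \<Rightarrow> (nat \<Rightarrow> nat) \<Rightarrow> nat list" where
  "rword n w = (SOME ws. red_word n w ws)"

definition Tw :: "nat \<Rightarrow> (nat \<Rightarrow> nat) \<Rightarrow> fa" where
  "Tw n w = fprod (map (\<lambda>i. fgen (GT i)) (rword n w))"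

definition Tbar_i :: "nat \<Rightarrow> fa" where
  "Tbar_i i = fgen (GT i) + fgen Gp - fgen Gq"

definition Tbarw :: "nat \<Rightarrow> (nat \<Rightarrow> nat) \<Rightarrow> fa" where
  "Tbarw n w = fprod (map Tbar_i (rword n w))"

text \<open>lam ! (i-1) is lambda_i.\<close>
definition parts :: "nat \<Rightarrow> nat \<Rightarrow> nat list set" where
  "parts n k = {lam. length lam = k \<and> (\<forall>i<k. lam ! i \<le> n - k) \<and> sorted (rev lam)}"

definition wlam :: "nat \<Rightarrow> nat \<Rightarrow> nat list \<Rightarrow> nat \<Rightarrow> nat" where
  "wlam n k lam = (THE w. w permutes {1..n}
      \<and> (\<forall>i\<in>{1..k}. w (k + 1 - i) = lam ! (i - 1) + k + 1 - i)
      \<and> strict_mono_on {k+1..n} w)"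

definition dkn :: "nat \<Rightarrow> nat \<Rightarrow> nat" where
  "dkn n k = (k choose 2) + ((n - k) choose 2)"

definition Sigma_nk :: "nat \<Rightarrow> nat \<Rightarrow> fa" where
  "Sigma_nk n k = fmul (fgen Gc) (\<Sum>v\<in>young n k. fmul (fpow Gq (dkn n k - plen n v)) (Tbarw n v))"

definition Tbar_lam :: "nat \<Rightarrow> nat \<Rightarrow> nat list \<Rightarrow> fa" where
  "Tbar_lam n k lam = fmul (Tbarw n (wlam n k lam)) (Sigma_nk n k)"

text \<open>Commutative polynomials with rational coefficients in the variables Gp, Gq, Gh, GX i.\<close>
type_synonym mpoly = "(gen \<Rightarrow>\<^sub>0 nat) \<Rightarrow>\<^sub>0 rat"

definition is_Ahx :: "nat \<Rightarrow> mpoly \<Rightarrow> bool" where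
  "is_Ahx n f \<longleftrightarrow> (\<forall>m\<in>Poly_Mapping.keys f. \<forall>v\<in>Poly_Mapping.keys m. scal_gen v \<or> (\<exists>i. v = GX i \<and> 1 \<le> i \<and> i \<le> n))"

definition gen_rename :: "(nat \<Rightarrow> nat) \<Rightarrow> gen \<Rightarrow> gen" where
  "gen_rename s g = (case g of GX i \<Rightarrow> GX (s i) | _ \<Rightarrow> g)"

definition mp_rename :: "(nat \<Rightarrow> nat) \<Rightarrow> mpoly \<Rightarrow> mpoly" where
  "mp_rename s f = (\<Sum>m\<in>Poly_Mapping.keys f. Poly_Mapping.single
       (\<Sum>v\<in>Poly_Mapping.keys m. Poly_Mapping.single (gen_rename s v) (Poly_Mapping.lookup m v)) (Poly_Mapping.lookup f m))"

definition block_symmetric :: "nat \<Rightarrow> nat \<Rightarrow> mpoly \<Rightarrow> bool" where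
  "block_symmetric n k f \<longleftrightarrow> (\<forall>s\<in>young n k. mp_rename s f = f)"

definition mono_word :: "(gen \<Rightarrow>\<^sub>0 nat) \<Rightarrow> gen list" where
  "mono_word m = concat (map (\<lambda>v. replicate (Poly_Mapping.lookup m v) v) (SOME xs. distinct xs \<and> set xs = Poly_Mapping.keys m))"

definition mp_to_fa :: "mpoly \<Rightarrow> fa" where
  "mp_to_fa f = (\<Sum>m\<in>Poly_Mapping.keys f. Poly_Mapping.single (mono_word m) (Poly_Mapping.lookup f m))"

definition mp_eval :: "(gen \<Rightarrow> 'f::field_char_0) \<Rightarrow> mpoly \<Rightarrow> 'f" where
  "mp_eval val f = (\<Sum>m\<in>Poly_Mapping.keys f. of_rat (Poly_Mapping.lookup f m) * (\<Prod>v\<in>Poly_Mapping.keys m. val v ^ Poly_Mapping.lookup m v))"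

definition gen_act :: "nat \<Rightarrow> ('f \<Rightarrow> 'v \<Rightarrow> 'v) \<Rightarrow> 'f \<Rightarrow> 'f \<Rightarrow> 'f \<Rightarrow>
    (nat \<Rightarrow> 'v \<Rightarrow> 'v) \<Rightarrow> (nat \<Rightarrow> 'v \<Rightarrow> 'v) \<Rightarrow> gen \<Rightarrow> 'v \<Rightarrow> ('v::ab_group_add)" where
  "gen_act n scale pF qF hF Top Xop g = (case g of
      Gp \<Rightarrow> scale pF | Gq \<Rightarrow> scale qF | Gh \<Rightarrow> scale hF
    | GT i \<Rightarrow> (if 1 \<le> i \<and> i < n then Top i else (\<lambda>_. 0))
    | GX i \<Rightarrow> (if 1 \<le> i \<and> i \<le> n then Xop i else (\<lambda>_. 0))
    | Gc \<Rightarrow> (\<lambda>_. 0))"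

definition vact :: "nat \<Rightarrow> ('f::field_char_0 \<Rightarrow> 'v \<Rightarrow> 'v) \<Rightarrow> 'f \<Rightarrow> 'f \<Rightarrow> 'f \<Rightarrow>
    (nat \<Rightarrow> 'v \<Rightarrow> 'v) \<Rightarrow> (nat \<Rightarrow> 'v \<Rightarrow> 'v) \<Rightarrow> fa \<Rightarrow> 'v \<Rightarrow> ('v::ab_group_add)" where
  "vact n scale pF qF hF Top Xop a x = (\<Sum>u\<in>Poly_Mapping.keys a.
      scale (of_rat (Poly_Mapping.lookup a u)) (foldr (\<lambda>g h. gen_act n scale pF qF hF Top Xop g \<circ> h) u id x))"

text \<open>V (type 'v) is an F-vector space (F of type 'f, char 0 since it receives a ring map from
  A_hbar containing Q; the map sends p,q,hbar to pF,qF,hF) with an F-linear action of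
  \<open>\<widehat>H_n\<close> (Top i = T_i, Xop i = x_i), basis Y_w, w in S_n, with
  Y_w = T_{w^-1 w0} Y_{w0}, and an F-linear ev as in the definition.\<close>
definition schubert_rep :: "nat \<Rightarrow> ('f::field_char_0 \<Rightarrow> 'v \<Rightarrow> ('v::ab_group_add)) \<Rightarrow> 'f \<Rightarrow> 'f \<Rightarrow> 'f
    \<Rightarrow> (nat \<Rightarrow> 'f) \<Rightarrow> (nat \<Rightarrow> 'v \<Rightarrow> 'v) \<Rightarrow> (nat \<Rightarrow> 'v \<Rightarrow> 'v)
    \<Rightarrow> ((nat \<Rightarrow> nat) \<Rightarrow> 'v) \<Rightarrow> ('v \<Rightarrow> 'f) \<Rightarrow> bool" where
  "schubert_rep n scale pF qF hF t Top Xop Y ev \<longleftrightarrow>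
     vector_space scale
   \<and> (\<forall>i. 1 \<le> i \<and> i < n \<longrightarrow> Vector_Spaces.linear scale scale (Top i))
   \<and> (\<forall>i. 1 \<le> i \<and> i \<le> n \<longrightarrow> Vector_Spaces.linear scale scale (Xop i))
   \<and> (\<forall>r\<in>hrel n. \<forall>x. vact n scale pF qF hF Top Xop r x = 0)
   \<and> inj_on Y (Sn n)
   \<and> \<not> module.dependent scale (Y ` Sn n)
   \<and> module.span scale (Y ` Sn n) = UNIV
   \<and> (\<forall>w\<in>Sn n. Y w = vact n scale pF qF hF Top Xop (Tw n (inv w \<circ> w0 n)) (Y (w0 n)))
   \<and> Vector_Spaces.linear scale (*) ev
   \<and> (\<forall>w\<in>Sn n. ev (Y w) \<noteq> 0 \<longleftrightarrow> w = id)
   \<and> (\<forall>w\<in>Sn n. \<forall>i. 1 \<le> i \<and> i \<le> n \<longrightarrow> ev (Xop i (Y w)) = t i * ev (Y w))"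

definition Y_lam :: "nat \<Rightarrow> nat \<Rightarrow> ('f::field_char_0 \<Rightarrow> 'v \<Rightarrow> ('v::ab_group_add)) \<Rightarrow> 'f
    \<Rightarrow> ((nat \<Rightarrow> nat) \<Rightarrow> 'v) \<Rightarrow> nat list \<Rightarrow> 'v" where
  "Y_lam n k scale pF Y lam = (\<Sum>v\<in>young n k. scale (pF ^ plen n v) (Y (wlam n k lam \<circ> v)))"

definition eval_val :: "'f \<Rightarrow> 'f \<Rightarrow> 'f \<Rightarrow> (nat \<Rightarrow> 'f) \<Rightarrow> gen \<Rightarrow> ('f::field_char_0)" where
  "eval_val pF qF hF t g = (case g of Gp \<Rightarrow> pF | Gq \<Rightarrow> qF | Gh \<Rightarrow> hF | GX i \<Rightarrow> t i | _ \<Rightarrow> 0)"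

end

theory Submission
  imports Defs "HOL-Library.Multiset"
begin

text \<open>Write \<open>\<T>\<^sub>w\<close> for \<open>Tbarw n w\<close>. Pushing \<open>\<T>\<^sub>w\<close> past a polynomial letter by letter gives
  \<open>\<T>\<^sub>w f = \<Sum>\<^sub>u c\<^sub>u \<T>\<^sub>u\<close> with polynomial coefficients \<open>c\<^sub>u\<close>. A block-symmetric \<open>f\<close> commutes with
  \<open>\<T>\<^sub>i\<close> for \<open>i \<noteq> k\<close>, hence with the symmetrizer, and \<open>\<T>\<^sub>v\<close> acts on the symmetrizer as
  \<open>p\<^bsup>\<ell>(v)\<^esup>\<close> for \<open>v\<close> in the Young subgroup. Factoring \<open>u = w\<^sub>\<lambda> v\<close> therefore yields part (i) with
  \<open>P\<^bsub>\<lambda>,\<mu>\<^esub> = \<Sum>\<^sub>v p\<^bsup>\<ell>(v)\<^esup> c\<^bsub>w\<^sub>\<lambda>v\<^esub>\<close>, the \<open>c\<close> being those of \<open>w = w\<^sub>\<mu>\<close>.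
  For part (ii), \<open>ev(\<T>\<^sub>w Y\<^sub>u) = \<delta>\<^bsub>w,u\<^esub> ev(Y\<^sub>i\<^sub>d)\<close>, so a vector is determined by the numbers
  \<open>ev(\<T>\<^sub>w y)\<close>. Since \<open>\<T>\<^sub>v Y\<^sub>\<lambda> = p\<^bsup>\<ell>(v)\<^esup> Y\<^sub>\<lambda>\<close>, the expansion of (i), before multiplying by the
  symmetrizer, computes these numbers for \<open>f Y\<^sub>\<lambda>\<close>.\<close>

subsection \<open>Length of permutations\<close>

text \<open>The inverse of \<open>[k]![n-k]!\<close> exists only in the localized algebra; in a
  Schubert representation this scalar may act as zero, so (ii) cannot be read off from (i). Both
  parts are therefore drawn from one identity without denominators, the expansion of
  \<open>Tbarw n (wlam n k mu)\<close> times \<open>f\<close> modulo \<open>rels n\<close>, and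
  \<open>P\<close> is chosen from it before a representation is fixed. Its entries are controlled
  only through their classes in the quotient; this suffices because \<open>ev\<close> recovers the
  value of a polynomial at \<open>t\<close> from the action of its class. The two weightings have a
  common origin. X = \<open>Tbar_i i\<close> satisfies (X - p)(X + q) = 0, so X multiplies q + X by
  p; the powers of q in the symmetrizer and the powers of p in the Schubert classes make both of
  them eigenvectors with eigenvalue p for every i \<noteq> k. To have ring arithmetic in place of
  congruences, the computations take place in the image of a homomorphism from the free algebra; at
  the end they are pulled back to the ideal or pushed to the action on V.\<close>

abbreviation adj :: "nat \<Rightarrow> nat \<Rightarrow> nat" where
  "adj i \<equiv> transpose i (Suc i)"

definition inversions :: "nat \<Rightarrow> (nat \<Rightarrow> nat) \<Rightarrow> (nat \<times> nat) set" where
  "inversions n w = {(i, j). 1 \<le> i \<and> i < j \<and> j \<le> n \<and> w j < w i}"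

lemma plen_eq_card_inversions: "plen n w = card (inversions n w)"
  by (simp add: plen_def inversions_def)

lemma finite_inversions: "finite (inversions n w)"
  by (rule finite_subset[of _ "{1..n} \<times> {1..n}"]) (auto simp: inversions_def)

lemma adj_less_adj: "a < b \<Longrightarrow> (a, b) \<noteq> (i, Suc i) \<Longrightarrow> adj i a < adj i b"
  by (auto simp: transpose_def)

lemma adj_in_range: "1 \<le> i \<Longrightarrow> i < n \<Longrightarrow> 1 \<le> a \<Longrightarrow> a \<le> n \<Longrightarrow> 1 \<le> adj i a \<and> adj i a \<le> n"
  by (auto simp: transpose_def)

lemma comp_adj_adj [simp]: "w \<circ> adj i \<circ> adj i = w"
  by (simp add: fun_eq_iff)

lemma adj_adj_comp [simp]: "adj i \<circ> (adj i \<circ> w) = w"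
  by (simp add: fun_eq_iff)

text \<open>Apply s_i to both entries of a pair. It reverses only the pair (i, Suc i) and keeps the
  order of all others, so it matches the inversions of \<open>w\<close> with those of the product
  other than (i, Suc i), which is the one new inversion.\<close>

lemma plen_comp_adj_ascent:
  assumes "1 \<le> i" "i < n" "w i < w (Suc i)"
  shows "plen n (w \<circ> adj i) = Suc (plen n w)"
proof -
  let ?h = "\<lambda>(a, b). (adj i a, adj i b)"
  have eq: "inversions n (w \<circ> adj i) = insert (i, Suc i) (?h ` inversions n w)" (is "?L = ?R")
  proof
    show "?L \<subseteq> ?R"
    proof
      fix z assume z: "z \<in> ?L"
      obtain a b where ab: "z = (a, b)" by (cases z)
      show "z \<in> ?R"
      proof (cases "z = (i, Suc i)")
        case False
        have "?h z \<in> inversions n w"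
          using z False assms ab adj_less_adj[of a b i] adj_in_range[of i n a] adj_in_range[of i n b]
          by (auto simp: inversions_def)
        moreover have "z = ?h (?h z)" using ab by simp
        ultimately show ?thesis by blast
      qed simp
    qed
    show "?R \<subseteq> ?L"
    proof
      fix z assume "z \<in> ?R"
      then consider "z = (i, Suc i)" | a b where "(a, b) \<in> inversions n w" "z = (adj i a, adj i b)"
        by auto
      then show "z \<in> ?L"
      proof cases
        case 1 then show ?thesis using assms by (auto simp: inversions_def)
      next
        case 2
        then have "(a, b) \<noteq> (i, Suc i)" using assms by (auto simp: inversions_def)
        then show ?thesis using 2 adj_less_adj[of a b i] adj_in_range[of i n a] adj_in_range[of i n b] assms
          by (auto simp: inversions_def)
      qed
    qed
  qed
  have "(i, Suc i) \<notin> ?h ` inversions n w"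
    by (auto simp: inversions_def transpose_def split: if_splits)
  moreover have "inj_on ?h (inversions n w)"
    by (auto simp: inj_on_def transpose_eq_iff)
  ultimately show ?thesis
    by (simp add: plen_eq_card_inversions eq finite_inversions card_image)
qed

lemma plen_comp_adj_descent:
  assumes "1 \<le> i" "i < n" "w (Suc i) < w i"
  shows "plen n w = Suc (plen n (w \<circ> adj i))"
  using plen_comp_adj_ascent[of i n "w \<circ> adj i"] assms by simp

lemma plen_comp_adj_le:
  assumes "1 \<le> i" "i < n" "inj w"
  shows "plen n (w \<circ> adj i) \<le> Suc (plen n w)" "plen n w \<le> Suc (plen n (w \<circ> adj i))"
proof -
  have "w i \<noteq> w (Suc i)" using assms by (simp add: inj_eq)
  then consider "w i < w (Suc i)" | "w (Suc i) < w i" by linarith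
  then have "plen n (w \<circ> adj i) \<le> Suc (plen n w) \<and> plen n w \<le> Suc (plen n (w \<circ> adj i))"
  proof cases
    case 1 then show ?thesis using plen_comp_adj_ascent[of i n w] assms by simp
  next
    case 2 then show ?thesis using plen_comp_adj_descent[of i n w] assms by simp
  qed
  then show "plen n (w \<circ> adj i) \<le> Suc (plen n w)" "plen n w \<le> Suc (plen n (w \<circ> adj i))" by auto
qed

text \<open>An inversion (a, b) of \<open>w\<close> becomes the inversion (w b, w a) of the inverse.
  This reduces left multiplication to right multiplication.\<close>

lemma plen_inv:
  assumes "w permutes {1..n}"
  shows "plen n (inv w) = plen n w"
proof -
  have r: "1 \<le> w a \<longleftrightarrow> 1 \<le> a" "w a \<le> n \<longleftrightarrow> a \<le> n" if "w permutes {1..n}" for a w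
  proof -
    have "w a \<in> {1..n} \<longleftrightarrow> a \<in> {1..n}" "a \<notin> {1..n} \<Longrightarrow> w a = a"
      using permutes_in_image[OF that] permutes_not_in[OF that] by blast+
    then show "1 \<le> w a \<longleftrightarrow> 1 \<le> a" "w a \<le> n \<longleftrightarrow> a \<le> n"
      by (cases "a \<in> {1..n}"; auto)+
  qed
  note r = r[OF assms] r[OF permutes_inv[OF assms]]
  have i: "inv w (w a) = a" "w (inv w a) = a" for a
    using permutes_inverses[OF assms] by auto
  have "bij_betw (\<lambda>(a, b). (w b, w a)) (inversions n w) (inversions n (inv w))"
  proof (rule bij_betw_byWitness[where f' = "\<lambda>(a, b). (inv w b, inv w a)"])
    show "(\<lambda>(a, b). (w b, w a)) ` inversions n w \<subseteq> inversions n (inv w)"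
      by (clarsimp simp: inversions_def i r simp del: One_nat_def)
    show "(\<lambda>(a, b). (inv w b, inv w a)) ` inversions n (inv w) \<subseteq> inversions n w"
      by (clarsimp simp: inversions_def i r simp del: One_nat_def)
  qed (auto simp: i)
  then show ?thesis
    by (simp add: plen_eq_card_inversions bij_betw_same_card)
qed

lemma plen_id [simp]: "plen n id = 0"
proof -
  have "inversions n id = {}" by (auto simp: inversions_def)
  then show ?thesis by (simp add: plen_eq_card_inversions)
qed

lemma strict_mono_on_SucI:
  fixes w :: "nat \<Rightarrow> nat"
  assumes "\<And>i. a \<le> i \<Longrightarrow> i < b \<Longrightarrow> w i < w (Suc i)"
  shows "strict_mono_on {a..b} w"
proof (rule strict_mono_onI)
  fix r s assume rs: "r \<in> {a..b}" "s \<in> {a..b}" "r < s"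
  have "s \<le> b \<longrightarrow> w r < w s" using Suc_leI[OF \<open>r < s\<close>]
  proof (induction s rule: dec_induct)
    case base
    then show ?case using assms[of r] rs by auto
  next
    case (step m)
    then show ?case using assms[of m] rs by auto
  qed
  then show "w r < w s" using rs by auto
qed

text \<open>Both maps list the same finite set in increasing order, and a sorted list without
  repetition is determined by its set.\<close>

lemma strict_mono_on_image_unique:
  fixes f g :: "nat \<Rightarrow> nat"
  assumes "strict_mono_on {a..b} f" "strict_mono_on {a..b} g" "f ` {a..b} = g ` {a..b}" "x \<in> {a..b}"
  shows "f x = g x"
proof -
  have srt: "sorted (map h [a..<Suc b])" "distinct (map h [a..<Suc b])"
    if "strict_mono_on {a..b} h" for h :: "nat \<Rightarrow> nat"
  proof -
    have "sorted_wrt (<) (map h [a..<Suc b])"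
      unfolding sorted_wrt_map using that
      by (auto simp: sorted_wrt_iff_nth_less strict_mono_onD simp del: upt_Suc)
    then show "sorted (map h [a..<Suc b])" "distinct (map h [a..<Suc b])"
      using strict_sorted_iff by blast+
  qed
  have "map f [a..<Suc b] = map g [a..<Suc b]"
    by (rule sorted_distinct_set_unique)
       (use srt assms in \<open>auto simp: atLeastLessThanSuc_atLeastAtMost simp del: upt_Suc\<close>)
  then show ?thesis using assms(4) by (auto simp del: upt_Suc)
qed

section \<open>Young subgroups and induction along reduced words\<close>

lemma Sn_eq_young: "Sn n = young n n"
  using permutes_image[where S = "{1..n}"] by (auto simp: Sn_def young_def)

lemma finite_young [simp]: "finite (young n k)"
  by (rule finite_subset[of _ "{v. v permutes {1..n}}"]) (auto simp: young_def finite_permutations)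

lemma finite_Sn [simp]: "finite (Sn n)"
  by (simp add: Sn_eq_young)

lemma young_subset_Sn: "young n k \<subseteq> Sn n"
  by (auto simp: young_def Sn_def)

lemma id_in_young [simp]: "id \<in> young n k"
  by (simp add: young_def permutes_id)

lemma id_in_Sn [simp]: "id \<in> Sn n"
  by (simp add: Sn_eq_young)

lemma comp_in_young: "v \<in> young n k \<Longrightarrow> u \<in> young n k \<Longrightarrow> v \<circ> u \<in> young n k"
  unfolding young_def mem_Collect_eq image_comp[symmetric] by (metis permutes_compose)

lemma comp_in_Sn: "v \<in> Sn n \<Longrightarrow> u \<in> Sn n \<Longrightarrow> v \<circ> u \<in> Sn n"
  by (simp add: Sn_eq_young comp_in_young)

lemma inv_in_young:
  assumes "v \<in> young n k"
  shows "inv v \<in> young n k"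
proof -
  have p: "v permutes {1..n}" and im: "v ` {1..k} = {1..k}" using assms by (auto simp: young_def)
  have "inv v ` {1..k} = inv v ` v ` {1..k}" using im by simp
  also have "\<dots> = {1..k}" using permutes_inj[OF p] by (simp add: image_comp)
  finally show ?thesis using permutes_inv[OF p] by (simp add: young_def)
qed

lemma inv_in_Sn: "v \<in> Sn n \<Longrightarrow> inv v \<in> Sn n"
  by (simp add: Sn_eq_young inv_in_young)

lemma inj_Sn: "w \<in> Sn n \<Longrightarrow> inj w"
  by (auto simp: Sn_def dest: permutes_inj)

lemma inv_Sn_apply:
  assumes "w \<in> Sn n"
  shows "inv w (w a) = a" "w (inv w a) = a"
  using permutes_inverses assms by (auto simp: Sn_def)

lemma adj_in_young:
  assumes "1 \<le> i" "i < n" "i \<noteq> k"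
  shows "adj i \<in> young n k"
proof -
  have "adj i ` {1..k} \<subseteq> {1..k}" using assms by (auto simp: transpose_def)
  then have "adj i ` {1..k} = {1..k}"
    by (intro card_subset_eq card_image) (auto simp: inj_on_def transpose_eq_iff)
  moreover have "adj i permutes {1..n}" using assms by (intro permutes_swap_id) auto
  ultimately show ?thesis by (simp add: young_def)
qed

lemma adj_in_Sn: "1 \<le> i \<Longrightarrow> i < n \<Longrightarrow> adj i \<in> Sn n"
  by (simp add: Sn_eq_young adj_in_young)

lemma young_upper_block:
  assumes "v \<in> young n k" "k \<le> n"
  shows "v ` {k+1..n} = {k+1..n}"
proof -
  have p: "v permutes {1..n}" and im: "v ` {1..k} = {1..k}" using assms by (auto simp: young_def)
  have "{k+1..n} = {1..n} - {1..k}" using assms(2) by auto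
  then show ?thesis
    using permutes_inj[OF p] permutes_image[OF p] im by (simp add: image_set_diff)
qed

lemma blockwise_ascending:
  fixes w :: "nat \<Rightarrow> nat"
  assumes "k \<le> n" "inj w" "\<And>i. 1 \<le> i \<Longrightarrow> i < n \<Longrightarrow> i \<noteq> k \<Longrightarrow> \<not> w (Suc i) < w i"
  shows "strict_mono_on {1..k} w" "strict_mono_on {k+1..n} w"
proof -
  have "w i < w (Suc i)" if "1 \<le> i" "i < n" "i \<noteq> k" for i
    using assms(3)[OF that] inj_eq[OF assms(2), of i "Suc i"] by (metis n_not_Suc_n linorder_neqE_nat)
  then show "strict_mono_on {1..k} w" "strict_mono_on {k+1..n} w"
    using assms(1) by (auto intro!: strict_mono_on_SucI)
qed

lemma young_ascending_imp_id:
  assumes "v \<in> young n k" "k \<le> n" "strict_mono_on {1..k} v" "strict_mono_on {k+1..n} v"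
  shows "v = id"
proof
  fix x
  have p: "v permutes {1..n}" and im: "v ` {1..k} = {1..k}" using assms by (auto simp: young_def)
  have m: "strict_mono_on A (id :: nat \<Rightarrow> nat)" for A by (auto intro: strict_mono_onI)
  consider "x \<in> {1..k}" | "x \<in> {k+1..n}" | "x \<notin> {1..n}" using assms(2) by fastforce
  then show "v x = id x"
  proof cases
    case 1 then show ?thesis using strict_mono_on_image_unique[OF assms(3) m] im by simp
  next
    case 2 then show ?thesis
      using strict_mono_on_image_unique[OF assms(4) m] young_upper_block[OF assms(1,2)] by simp
  next
    case 3 then show ?thesis using permutes_not_in[OF p] by simp
  qed
qed

text \<open>Unwinds a reduced word from the right. A nonidentity element of the Young subgroup is
  not increasing on both blocks, so it has a descent at some i \<noteq> k; removing it shortens the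
  element and stays in the subgroup. The step hands out the ascent \<open>v i < v (Suc i)\<close>
  that the length and product lemmas ask for.\<close>

lemma young_induct [consumes 2, case_names id ascent]:
  assumes "v \<in> young n k" "k \<le> n"
    and "P id"
    and step: "\<And>v i. v \<in> young n k \<Longrightarrow> 1 \<le> i \<Longrightarrow> i < n \<Longrightarrow> i \<noteq> k \<Longrightarrow> v i < v (Suc i) \<Longrightarrow>
      v \<circ> adj i \<in> young n k \<Longrightarrow> P v \<Longrightarrow> P (v \<circ> adj i)"
  shows "P v"
  using assms(1)
proof (induction "plen n v" arbitrary: v rule: less_induct)
  case less
  show ?case
  proof (cases "v = id")
    case False
    have "inj v" using less.prems young_subset_Sn inj_Sn by blast
    then obtain i where i: "1 \<le> i" "i < n" "i \<noteq> k" "v (Suc i) < v i"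
      using blockwise_ascending[OF assms(2), of v] young_ascending_imp_id[OF less.prems assms(2)] False
      by blast
    let ?u = "v \<circ> adj i"
    have u: "?u \<in> young n k" using less.prems i by (intro comp_in_young adj_in_young)
    have "P ?u" using plen_comp_adj_descent[of i n v] i by (intro less.hyps u) simp
    then show ?thesis using step[OF u i(1-3)] i less.prems by simp
  qed (use assms(3) in simp)
qed

text \<open>With k = n the Young subgroup is all of \<open>Sn n\<close>, so the same rule is
  induction on length in the symmetric group.\<close>

lemmas Sn_induct = young_induct[where k = n and n = n for n, folded Sn_eq_young, OF _ order_refl, consumes 1, case_names id ascent]

subsection \<open>Reduced words\<close>

lemma sprod_Nil [simp]: "sprod [] = id"
  by (simp add: sprod_def)

lemma sprod_Cons [simp]: "sprod (i # ws) = adj i \<circ> sprod ws"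
  by (simp add: sprod_def)

lemma sprod_append: "sprod (us @ ws) = sprod us \<circ> sprod ws"
  by (induction us) (simp_all add: comp_assoc)

lemma sprod_snoc: "sprod (ws @ [i]) = sprod ws \<circ> adj i"
  by (simp add: sprod_append)

lemma sprod_in_Sn: "\<forall>i\<in>set ws. 1 \<le> i \<and> i < n \<Longrightarrow> sprod ws \<in> Sn n"
  by (induction ws) (auto intro!: comp_in_Sn adj_in_Sn)

lemma plen_sprod_le: "\<forall>i\<in>set ws. 1 \<le> i \<and> i < n \<Longrightarrow> plen n (sprod ws) \<le> length ws"
proof (induction ws rule: rev_induct)
  case (snoc i ws)
  then have "plen n (sprod (ws @ [i])) \<le> Suc (plen n (sprod ws))"
    unfolding sprod_snoc by (intro plen_comp_adj_le(1) inj_Sn[OF sprod_in_Sn]) auto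
  also have "\<dots> \<le> Suc (length ws)" using snoc by simp
  finally show ?case by simp
qed simp

text \<open>A prefix of length m spells an element of length at most m, and one more letter changes
  the length by at most one. In a reduced word both bounds are attained, which forces the prefix to
  be reduced and the final letter to be a descent.\<close>

lemma red_word_snoc_iff:
  assumes "1 \<le> i" "i < n"
  shows "red_word n w (ws @ [i]) \<longleftrightarrow> red_word n (w \<circ> adj i) ws \<and> w (Suc i) < w i"
proof
  assume r: "red_word n w (ws @ [i])"
  then have ws: "\<forall>i\<in>set ws. 1 \<le> i \<and> i < n" and w: "w = sprod ws \<circ> adj i" and l: "plen n w = Suc (length ws)"
    by (auto simp: red_word_def sprod_snoc)
  have inj: "inj (sprod ws)" using inj_Sn[OF sprod_in_Sn[OF ws]] .
  have "plen n (sprod ws) = length ws"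
    using plen_sprod_le[OF ws] plen_comp_adj_le(1)[OF assms inj] l w by simp
  moreover have "w (Suc i) < w i"
  proof (rule ccontr)
    assume "\<not> w (Suc i) < w i"
    then have "sprod ws (Suc i) < sprod ws i" using w inj_eq[OF inj, of i "Suc i"] by (simp add: nat_neq_iff)
    from plen_comp_adj_descent[OF assms this] show False using plen_sprod_le[OF ws] l w by simp
  qed
  ultimately show "red_word n (w \<circ> adj i) ws \<and> w (Suc i) < w i"
    using ws w by (simp add: red_word_def)
next
  assume r: "red_word n (w \<circ> adj i) ws \<and> w (Suc i) < w i"
  have "sprod (ws @ [i]) = w" using r by (simp add: red_word_def sprod_snoc)
  then show "red_word n w (ws @ [i])" using r plen_comp_adj_descent[OF assms, of w] assms
    by (auto simp: red_word_def)
qed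

lemma ex_red_word:
  assumes "w \<in> Sn n"
  shows "\<exists>ws. red_word n w ws"
  using assms
proof (induction rule: Sn_induct)
  case id
  have "red_word n id []" by (simp add: red_word_def)
  then show ?case by blast
next
  case (ascent v i)
  then obtain ws where "red_word n v ws" by blast
  then have "red_word n (v \<circ> adj i) (ws @ [i])"
    using ascent by (simp add: red_word_snoc_iff)
  then show ?case by blast
qed

lemma red_word_rword: "w \<in> Sn n \<Longrightarrow> red_word n w (rword n w)"
  unfolding rword_def using ex_red_word by (rule someI_ex)

text \<open>Matsumoto's theorem. Two words ending in distinct letters \<open>i\<close>, \<open>j\<close> are compared through a
  common reduced word ending in the longest element of the parabolic subgroup generated by
  \<open>s\<^sub>i\<close> and \<open>s\<^sub>j\<close>.\<close>

lemma red_word_unique_prod: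
  fixes g :: "nat \<Rightarrow> 'a::monoid_mult"
  assumes comm: "\<And>i j. 1 \<le> i \<Longrightarrow> Suc i < j \<Longrightarrow> j < n \<Longrightarrow> g i * g j = g j * g i"
    and braid: "\<And>i. 1 \<le> i \<Longrightarrow> Suc i < n \<Longrightarrow> g i * g (Suc i) * g i = g (Suc i) * g i * g (Suc i)"
  shows "red_word n w us \<Longrightarrow> red_word n w vs \<Longrightarrow> prod_list (map g us) = prod_list (map g vs)"
proof (induction "length us" arbitrary: w us vs rule: less_induct)
  case less
  have len: "length us = length vs" using less.prems by (simp add: red_word_def)
  show ?case
  proof (cases us rule: rev_cases)
    case Nil
    then show ?thesis using len by simp
  next
    case (snoc us' i)
    then obtain vs' j where vs: "vs = vs' @ [j]" using len by (cases vs rule: rev_cases) auto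
    have i: "1 \<le> i" "i < n" and j: "1 \<le> j" "j < n"
      using less.prems snoc vs by (auto simp: red_word_def)
    have ru: "red_word n (w \<circ> adj i) us'" "w (Suc i) < w i"
      using less.prems(1) snoc red_word_snoc_iff[OF i] by auto
    have rv: "red_word n (w \<circ> adj j) vs'" "w (Suc j) < w j"
      using less.prems(2) vs red_word_snoc_iff[OF j] by auto
    have w: "w \<in> Sn n" using less.prems(1) sprod_in_Sn by (auto simp: red_word_def)
    have lu: "length us' < length us" and lv: "length vs' < length us" using snoc vs len by auto
    \<comment> \<open>Stated for an unordered pair, so that it serves both orders of the two distant
      letters. The words are compared with \<open>zs\<close> followed by these letters in either
      order.\<close>
    have far: ?thesis
      if c: "g a * g b = g b * g a" and ab: "{a, b} = {i, j}" "Suc a < b" for a b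
    proof -
      have ij: "i \<noteq> j" "Suc i \<noteq> j" "Suc j \<noteq> i" "g i * g j = g j * g i" using ab c by (auto simp: doubleton_eq_iff)
      have "w \<circ> adj i \<circ> adj j \<in> Sn n" using w i j by (intro comp_in_Sn adj_in_Sn)
      then obtain zs where zs: "red_word n (w \<circ> adj i \<circ> adj j) zs" using ex_red_word by blast
      have eq: "w \<circ> adj i \<circ> adj j = w \<circ> adj j \<circ> adj i"
        using ij by (auto simp: fun_eq_iff transpose_def)
      have "red_word n (w \<circ> adj i) (zs @ [j])"
        using zs rv ij by (simp add: red_word_snoc_iff[OF j] transpose_def)
      moreover have "red_word n (w \<circ> adj j) (zs @ [i])"
        using zs ru ij eq by (simp add: red_word_snoc_iff[OF i] transpose_def)
      ultimately have "prod_list (map g us') = prod_list (map g zs) * g j"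
        "prod_list (map g vs') = prod_list (map g zs) * g i"
        using less.hyps[OF lu ru(1)] less.hyps[OF lv rv(1)] by auto
      then show ?thesis using snoc vs ij(4) by (simp add: mult.assoc)
    qed
    \<comment> \<open>Descents at two adjacent positions make \<open>w\<close> decreasing on three
      consecutive positions, so three letters can be stripped. With \<open>zs\<close> spelling the
      rest, \<open>us\<close> compares with zs i j i and \<open>vs\<close> with zs j i j, and the
      braid relation joins them.\<close>
    have near: "prod_list (map g us') * g i = prod_list (map g vs') * g j"
      if b: "g i * g j * g i = g j * g i * g j" and ij: "j = Suc i \<or> i = Suc j" 
    proof -
      have d: "w (Suc i) < w i" "w (Suc j) < w j" using ru rv by auto
      have "w \<circ> adj i \<circ> adj j \<circ> adj i \<in> Sn n" using w i j by (intro comp_in_Sn adj_in_Sn)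
      then obtain zs where zs: "red_word n (w \<circ> adj i \<circ> adj j \<circ> adj i) zs" using ex_red_word by blast
      have eq: "w \<circ> adj i \<circ> adj j \<circ> adj i = w \<circ> adj j \<circ> adj i \<circ> adj j"
        using ij by (auto simp: fun_eq_iff transpose_def)
      have "red_word n (w \<circ> adj i \<circ> adj j) (zs @ [i])"
        using zs d ij by (auto simp: red_word_snoc_iff[OF i] transpose_def)
      then have "red_word n (w \<circ> adj i) ((zs @ [i]) @ [j])"
        unfolding red_word_snoc_iff[OF j] using d ij by (auto simp: transpose_def)
      moreover have "red_word n (w \<circ> adj j \<circ> adj i) (zs @ [j])"
        using zs d ij eq by (auto simp: red_word_snoc_iff[OF j] transpose_def)
      then have "red_word n (w \<circ> adj j) ((zs @ [j]) @ [i])"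
        unfolding red_word_snoc_iff[OF i] using d ij by (auto simp: transpose_def)
      ultimately have "prod_list (map g us') = prod_list (map g zs) * g i * g j"
        "prod_list (map g vs') = prod_list (map g zs) * g j * g i"
        using less.hyps[OF lu ru(1)] less.hyps[OF lv rv(1)] by (auto simp: mult.assoc)
      then show ?thesis using b by (simp add: mult.assoc)
    qed
    consider "i = j" | "j = Suc i" | "i = Suc j" | "Suc i < j" | "Suc j < i" by linarith
    then show ?thesis
    proof cases
      case 1
      then show ?thesis using less.hyps[OF lu ru(1)] rv(1) snoc vs by auto
    next
      case 2
      then show ?thesis using near braid[of i] i j snoc vs by simp
    next
      case 3
      then show ?thesis using near braid[of j] i j snoc vs by simp
    next
      case 4
      then show ?thesis using far[of i j] comm[of i j] i j by simp
    next
      case 5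
      then show ?thesis using far[of j i] comm[of j i] i j by auto
    qed
  qed
qed

subsection \<open>Products along reduced words\<close>

text \<open>The element attached to \<open>w\<close> in an arbitrary monoid, so that T_w and its
  barred version are two instances of one construction.\<close>

definition wprod :: "nat \<Rightarrow> (nat \<Rightarrow> 'a::monoid_mult) \<Rightarrow> (nat \<Rightarrow> nat) \<Rightarrow> 'a" where
  "wprod n g w = prod_list (map g (rword n w))"

lemma young_same_block:
  assumes "v \<in> young n k" "k \<le> n" "1 \<le> i" "i < n" "i \<noteq> k"
  shows "{v i, v (Suc i)} \<subseteq> {1..k} \<or> {v i, v (Suc i)} \<subseteq> {k+1..n}"
proof -
  have "v ` {1..k} = {1..k}" using assms by (simp add: young_def)
  then show ?thesis using young_upper_block[OF assms(1,2)] assms(3-)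
    by (cases "i < k") (auto simp del: One_nat_def)
qed

lemma blockwise_ascending_comp_young:
  fixes w :: "nat \<Rightarrow> nat"
  assumes "v \<in> young n k" "k \<le> n" "1 \<le> i" "i < n" "i \<noteq> k" "v i < v (Suc i)"
    and "strict_mono_on {1..k} w" "strict_mono_on {k+1..n} w"
  shows "w (v i) < w (v (Suc i))"
  using young_same_block[OF assms(1-5)] assms(6-) unfolding strict_mono_on_def by blast

lemma plen_left_ascent:
  assumes "w \<in> Sn n" "1 \<le> i" "i < n" "inv w i < inv w (Suc i)"
  shows "plen n (adj i \<circ> w) = Suc (plen n w)"
proof -
  have bij: "bij w" using assms(1) by (auto simp: Sn_def dest: permutes_bij)
  have "adj i \<circ> w \<in> Sn n" using assms by (intro comp_in_Sn adj_in_Sn)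
  then have "plen n (adj i \<circ> w) = plen n (inv (adj i \<circ> w))" by (simp add: Sn_def plen_inv)
  also have "inv (adj i \<circ> w) = inv w \<circ> adj i" using bij by (simp add: o_inv_distrib)
  also have "plen n (inv w \<circ> adj i) = Suc (plen n w)"
    using assms plen_comp_adj_ascent[of i n "inv w"] by (simp add: plen_inv Sn_def)
  finally show ?thesis .
qed

text \<open>These relations make \<open>wprod\<close> independent of the arbitrarily chosen reduced
  word. They are shared by the T_i and the barred T_i, whose quadratic relations differ.\<close>

locale braid_family =
  fixes n :: nat and g :: "nat \<Rightarrow> 'a::monoid_mult"
  assumes comm: "\<And>i j. 1 \<le> i \<Longrightarrow> Suc i < j \<Longrightarrow> j < n \<Longrightarrow> g i * g j = g j * g i"
    and braid: "\<And>i. 1 \<le> i \<Longrightarrow> Suc i < n \<Longrightarrow> g i * g (Suc i) * g i = g (Suc i) * g i * g (Suc i)"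
begin

lemma wprod_red_word: "red_word n w ws \<Longrightarrow> wprod n g w = prod_list (map g ws)"
  unfolding wprod_def rword_def using red_word_unique_prod[of n g, OF comm braid] someI[of "red_word n w"]
  by metis

lemma wprod_id [simp]: "wprod n g id = 1"
  using wprod_red_word[of id "[]"] by (simp add: red_word_def)

lemma wprod_ascent:
  assumes "w \<in> Sn n" "1 \<le> i" "i < n" "w i < w (Suc i)"
  shows "wprod n g (w \<circ> adj i) = wprod n g w * g i"
proof -
  have "red_word n (w \<circ> adj i) (rword n w @ [i])"
    using assms red_word_rword[OF assms(1)] by (simp add: red_word_snoc_iff)
  from wprod_red_word[OF this] show ?thesis by (simp add: wprod_def)
qed

lemma wprod_left_ascent:
  assumes "w \<in> Sn n" "1 \<le> i" "i < n" "inv w i < inv w (Suc i)"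
  shows "wprod n g (adj i \<circ> w) = g i * wprod n g w"
proof -
  have "red_word n (adj i \<circ> w) (i # rword n w)"
    using plen_left_ascent[OF assms] assms red_word_rword[OF assms(1)] by (simp add: red_word_def)
  from wprod_red_word[OF this] show ?thesis by (simp add: wprod_def)
qed

text \<open>\<open>w\<close> is the shortest element of its coset: it preserves order inside the
  blocks, so each ascent met while building \<open>v\<close> letter by letter is also an ascent of
  \<open>w \<circ> v\<close>, and the concatenated word stays reduced.\<close>

lemma wprod_comp_young:
  assumes "v \<in> young n k" "k \<le> n" "w \<in> Sn n" "strict_mono_on {1..k} w" "strict_mono_on {k+1..n} w"
  shows "wprod n g (w \<circ> v) = wprod n g w * wprod n g v"
  using assms(1,2)
proof (induction rule: young_induct)
  case id
  show "wprod n g (w \<circ> id) = wprod n g w * wprod n g id" by simp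
next
  case (ascent v i)
  have v: "v \<in> Sn n" using ascent young_subset_Sn by blast
  have "w (v i) < w (v (Suc i))"
    using ascent assms by (intro blockwise_ascending_comp_young[of v n k i w]) auto
  then have "wprod n g ((w \<circ> v) \<circ> adj i) = wprod n g (w \<circ> v) * g i"
    using ascent v assms by (intro wprod_ascent comp_in_Sn) auto
  then show "wprod n g (w \<circ> (v \<circ> adj i)) = wprod n g w * wprod n g (v \<circ> adj i)"
    using ascent v by (simp add: wprod_ascent comp_assoc mult.assoc)
qed

end

text \<open>Pascal's rule: raising m adds m pairs with the new largest second entry. The offset
  \<open>a\<close> serves both blocks.\<close>

lemma card_pairs_le_choose_two:
  "finite {(i, j). a < i \<and> i < j \<and> j \<le> a + m} \<and> card {(i, j). a < i \<and> i < j \<and> j \<le> a + (m::nat)} \<le> m choose 2"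
proof (induction m)
  case 0
  have "{(i, j). a < i \<and> i < j \<and> j \<le> a + 0} = {}" by auto
  then show ?case by (simp only: card.empty finite.emptyI) simp
next
  case (Suc m)
  let ?A = "{(i, j). a < i \<and> i < j \<and> j \<le> a + m}" and ?B = "(\<lambda>i. (i, a + Suc m)) ` {a<..a+m}"
  have eq: "{(i, j). a < i \<and> i < j \<and> j \<le> a + Suc m} = ?A \<union> ?B" by auto
  have "card (?A \<union> ?B) \<le> card ?A + card ?B" by (rule card_Un_le)
  also have "card ?B \<le> m" using card_image_le[of "{a<..a+m}"] by fastforce
  also have "card ?A \<le> m choose 2" using Suc by simp
  finally have "card (?A \<union> ?B) \<le> (m choose 2) + m" by simp
  also have "\<dots> = Suc m choose 2" by (simp add: numeral_2_eq_2)
  finally show ?case using Suc unfolding eq by simp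
qed

text \<open>A block-preserving permutation has no inversion across the blocks. The bound makes the
  truncated subtraction in the exponent of q in \<open>Sigma_nk\<close> an honest one.\<close>

lemma plen_young_le_dkn:
  assumes "v \<in> young n k" "k \<le> n"
  shows "plen n v \<le> dkn n k"
proof -
  let ?A = "{(i, j). 0 < i \<and> i < j \<and> j \<le> 0 + k}" and ?B = "{(i, j). k < i \<and> i < j \<and> j \<le> k + (n - k)}"
  have im: "v ` {1..k} = {1..k}" "v ` {k+1..n} = {k+1..n}"
    using assms young_upper_block[OF assms] by (auto simp: young_def)
  have "inversions n v \<subseteq> ?A \<union> ?B"
  proof
    fix z assume z: "z \<in> inversions n v"
    then obtain i j where ij: "z = (i, j)" "1 \<le> i" "i < j" "j \<le> n" "v j < v i"
      by (auto simp: inversions_def)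
    have "\<not> (i \<le> k \<and> k < j)"
    proof
      assume "i \<le> k \<and> k < j"
      then have "v i \<in> {1..k}" "v j \<in> {k+1..n}" using im ij by auto
      then show False using ij by auto
    qed
    then show "z \<in> ?A \<union> ?B" using ij by auto
  qed
  then have "plen n v \<le> card (?A \<union> ?B)"
    unfolding plen_eq_card_inversions
    using card_pairs_le_choose_two[of 0 k] card_pairs_le_choose_two[of k "n - k"]
    by (intro card_mono) auto
  also have "\<dots> \<le> card ?A + card ?B" by (rule card_Un_le)
  also have "\<dots> \<le> dkn n k"
    unfolding dkn_def using card_pairs_le_choose_two[of 0 k] card_pairs_le_choose_two[of k "n - k"]
    by (intro add_mono) auto
  finally show ?thesis .
qed

subsection \<open>Grassmannian permutations\<close>

text \<open>Sorting by minimality: any permutation carrying the first block to \<open>A\<close> is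
  composed with an element of the Young subgroup that minimizes the length of the product. A
  remaining descent inside a block could be removed by an adjacent transposition of the
  subgroup.\<close>

lemma ex_blockwise_ascending:
  assumes "A \<subseteq> {1..n}" "card A = k" "k \<le> n"
  shows "\<exists>w\<in>Sn n. w ` {1..k} = A \<and> strict_mono_on {1..k} w \<and> strict_mono_on {k+1..n} w"
proof -
  have fA: "finite A" using assms(1) finite_subset by blast
  obtain f where f: "bij_betw f {1..k} A"
    using finite_same_card_bij[of "{1..k}" A] fA assms by auto
  have "card {k+1..n} = card ({1..n} - A)" using assms fA by (simp add: card_Diff_subset)
  then obtain g where g: "bij_betw g {k+1..n} ({1..n} - A)"
    using finite_same_card_bij[of "{k+1..n}" "{1..n} - A"] by auto
  define w where "w x = (if x \<in> {1..n} then (if x \<in> {1..k} then f x else g x) else x)" for x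
  have "bij_betw (\<lambda>x. if x \<in> {1..k} then f x else g x) ({1..k} \<union> {k+1..n}) (A \<union> ({1..n} - A))"
    by (intro bij_betw_disjoint_Un f g) auto
  moreover have "{1..k} \<union> {k+1..n} = {1..n}" "A \<union> ({1..n} - A) = {1..n}" using assms by auto
  ultimately have "bij_betw (\<lambda>x. if x \<in> {1..k} then f x else g x) {1..n} {1..n}" by simp
  then have "bij_betw w {1..n} {1..n}"
    by (rule iffD1[OF bij_betw_cong, rotated]) (simp add: w_def)
  then have w: "w \<in> Sn n"
    unfolding Sn_def mem_Collect_eq by (rule bij_imp_permutes) (auto simp: w_def)
  have "w ` {1..k} = f ` {1..k}" using assms(3) by (intro image_cong) (auto simp: w_def)
  then have im: "w ` {1..k} = A" using f by (simp add: bij_betw_def)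
  obtain v where v: "v \<in> young n k" and min: "\<And>u. u \<in> young n k \<Longrightarrow> plen n (w \<circ> v) \<le> plen n (w \<circ> u)"
    using ex_has_least_nat[of "\<lambda>v. v \<in> young n k" id "\<lambda>v. plen n (w \<circ> v)"] by auto
  have v': "v \<in> Sn n" using v young_subset_Sn by blast
  have "\<not> (w \<circ> v) (Suc i) < (w \<circ> v) i" if i: "1 \<le> i" "i < n" "i \<noteq> k" for i
  proof
    assume "(w \<circ> v) (Suc i) < (w \<circ> v) i"
    then have "plen n (w \<circ> v) = Suc (plen n (w \<circ> v \<circ> adj i))"
      using i by (intro plen_comp_adj_descent)
    moreover have "plen n (w \<circ> v) \<le> plen n (w \<circ> v \<circ> adj i)"
      using min[of "v \<circ> adj i"] v i by (simp add: comp_in_young adj_in_young comp_assoc)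
    ultimately show False by simp
  qed
  from blockwise_ascending[of k n "w \<circ> v", OF assms(3) _ this]
  have "strict_mono_on {1..k} (w \<circ> v)" "strict_mono_on {k+1..n} (w \<circ> v)"
    using inj_Sn comp_in_Sn[OF w v'] by blast+
  moreover have "(w \<circ> v) ` {1..k} = A" using v im unfolding image_comp[symmetric] young_def by simp
  ultimately show ?thesis using comp_in_Sn[OF w v'] by blast
qed

lemma blockwise_ascending_unique:
  assumes "w \<in> Sn n" "u \<in> Sn n" "k \<le> n" "w ` {1..k} = u ` {1..k}"
    and "strict_mono_on {1..k} w" "strict_mono_on {k+1..n} w"
    and "strict_mono_on {1..k} u" "strict_mono_on {k+1..n} u"
  shows "w = u"
proof
  fix x
  have p: "w permutes {1..n}" "u permutes {1..n}" using assms by (auto simp: Sn_def)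
  have "{k+1..n} = {1..n} - {1..k}" using assms(3) by auto
  then have im: "w ` {k+1..n} = u ` {k+1..n}"
    using permutes_inj[OF p(1)] permutes_image[OF p(1)] permutes_inj[OF p(2)] permutes_image[OF p(2)] assms(4)
    by (simp add: image_set_diff)
  consider "x \<in> {1..k}" | "x \<in> {k+1..n}" | "x \<notin> {1..n}" using assms(3) by fastforce
  then show "w x = u x"
  proof cases
    case 1 then show ?thesis using strict_mono_on_image_unique assms by blast
  next
    case 2 then show ?thesis using strict_mono_on_image_unique im assms by blast
  next
    case 3 then show ?thesis using permutes_not_in p by metis
  qed
qed

text \<open>Justifies the definite description in \<open>wlam\<close>. The prescribed values
  increase along the first block, so prescribing them amounts to prescribing the image of that
  block.\<close>

lemma wlam_unique_existence:
  assumes "lam \<in> parts n k" "k \<le> n"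
  shows "\<exists>!w. w permutes {1..n} \<and> (\<forall>i\<in>{1..k}. w (k + 1 - i) = lam ! (i - 1) + k + 1 - i)
      \<and> strict_mono_on {k+1..n} w"
proof -
  \<comment> \<open>The prescribed values read from left to right: with j = k + 1 - i, the list
    index i - 1 is k - j. Weakly decreasing parts make these values strictly increasing.\<close>
  define a where "a j = lam ! (k - j) + j" for j
  have len: "length lam = k" and bd: "\<And>i. i < k \<Longrightarrow> lam ! i \<le> n - k" and srt: "sorted (rev lam)"
    using assms by (auto simp: parts_def)
  have dec: "lam ! j \<le> lam ! i" if "i \<le> j" "j < k" for i j
    using that srt len by (auto simp: sorted_rev_iff_nth_mono)
  have a: "strict_mono_on {1..k} a"
  proof (rule strict_mono_onI)
    fix r s assume "r \<in> {1..k}" "s \<in> {1..k}" "r < s"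
    then show "a r < a s" using dec[of "k - s" "k - r"] by (simp add: a_def add_le_less_mono)
  qed
  have vals: "(\<forall>i\<in>{1..k}. w (k + 1 - i) = lam ! (i - 1) + k + 1 - i) \<longleftrightarrow> (\<forall>j\<in>{1..k}. w j = a j)" for w
  proof
    assume L: "\<forall>i\<in>{1..k}. w (k + 1 - i) = lam ! (i - 1) + k + 1 - i"
    show "\<forall>j\<in>{1..k}. w j = a j"
    proof
      fix j assume "j \<in> {1..k}"
      then have "k + 1 - j \<in> {1..k}" "k + 1 - (k + 1 - j) = j" by auto
      then show "w j = a j" using L[rule_format, of "k + 1 - j"] \<open>j \<in> {1..k}\<close> by (simp add: a_def)
    qed
  next
    assume L: "\<forall>j\<in>{1..k}. w j = a j"
    show "\<forall>i\<in>{1..k}. w (k + 1 - i) = lam ! (i - 1) + k + 1 - i"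
    proof
      fix i assume i: "i \<in> {1..k}"
      then have "k + 1 - i \<in> {1..k}" by auto
      then show "w (k + 1 - i) = lam ! (i - 1) + k + 1 - i" using L[rule_format, of "k + 1 - i"] i by (simp add: a_def)
    qed
  qed
  have sm: "strict_mono_on {1..k} w" if "\<forall>j\<in>{1..k}. w j = a j" for w
    using a that by (simp add: strict_mono_on_def)
  have "a ` {1..k} \<subseteq> {1..n}"
  proof
    fix x assume "x \<in> a ` {1..k}"
    then obtain j where "x = a j" "1 \<le> j" "j \<le> k" by auto
    then show "x \<in> {1..n}" using bd[of "k - j"] assms(2) by (simp add: a_def)
  qed
  moreover have "card (a ` {1..k}) = k" using strict_mono_on_imp_inj_on[OF a] by (simp add: card_image)
  ultimately obtain w where w: "w \<in> Sn n" "w ` {1..k} = a ` {1..k}" "strict_mono_on {1..k} w" "strict_mono_on {k+1..n} w"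
    using ex_blockwise_ascending[of "a ` {1..k}" n k] assms(2) by metis
  have wa: "\<forall>j\<in>{1..k}. w j = a j" using strict_mono_on_image_unique[OF w(3) a w(2)] by blast
  show ?thesis unfolding vals
  proof (rule ex1I[of _ w])
    show "w permutes {1..n} \<and> (\<forall>j\<in>{1..k}. w j = a j) \<and> strict_mono_on {k + 1..n} w"
      using w wa by (simp add: Sn_def)
    fix u assume u: "u permutes {1..n} \<and> (\<forall>j\<in>{1..k}. u j = a j) \<and> strict_mono_on {k + 1..n} u"
    show "u = w"
      by (rule blockwise_ascending_unique[of u n w k]) (use u w wa sm[of u] assms in \<open>auto simp: Sn_def\<close>)
  qed
qed

lemma
  assumes "lam \<in> parts n k" "k \<le> n"
  shows wlam_in_Sn: "wlam n k lam \<in> Sn n"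
    and wlam_lower: "j \<in> {1..k} \<Longrightarrow> wlam n k lam j = lam ! (k - j) + j"
    and wlam_ascending_lower: "strict_mono_on {1..k} (wlam n k lam)"
    and wlam_ascending_upper: "strict_mono_on {k+1..n} (wlam n k lam)"
proof -
  note w = theI'[OF wlam_unique_existence[OF assms], folded wlam_def]
  show "wlam n k lam \<in> Sn n" "strict_mono_on {k+1..n} (wlam n k lam)" using w by (auto simp: Sn_def)
  have v: "wlam n k lam j = lam ! (k - j) + j" if j: "j \<in> {1..k}" for j
  proof -
    have "k + 1 - j \<in> {1..k}" "k + 1 - (k + 1 - j) = j" using j by auto
    then show ?thesis using w[THEN conjunct2, THEN conjunct1, rule_format, of "k + 1 - j"] j by simp
  qed
  show "j \<in> {1..k} \<Longrightarrow> wlam n k lam j = lam ! (k - j) + j" by (rule v)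
  have "sorted (rev lam)" "length lam = k" using assms by (auto simp: parts_def)
  then have dec: "lam ! j \<le> lam ! i" if "i \<le> j" "j < k" for i j
    using that by (auto simp: sorted_rev_iff_nth_mono)
  show "strict_mono_on {1..k} (wlam n k lam)"
  proof (rule strict_mono_onI)
    fix r s assume "r \<in> {1..k}" "s \<in> {1..k}" "r < s"
    then show "wlam n k lam r < wlam n k lam s"
      using dec[of "k - s" "k - r"] by (simp add: v add_le_less_mono)
  qed
qed

lemma finite_parts [simp]: "finite (parts n k)"
proof (rule finite_subset)
  show "parts n k \<subseteq> {xs. set xs \<subseteq> {..n - k} \<and> length xs = k}"
    by (auto simp: parts_def in_set_conv_nth)
qed (simp add: finite_lists_length_eq)

text \<open>Let \<open>g\<close> be blockwise increasing with the same image of the first block as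
  \<open>w\<close>. Then \<open>inv g \<circ> w\<close> preserves that block, and \<open>g\<close>
  comes from the partition that measures how far its first values exceed 1, ..., k.\<close>

lemma ex_wlam_factorization:
  assumes "w \<in> Sn n" "k \<le> n"
  shows "\<exists>lam\<in>parts n k. \<exists>v\<in>young n k. w = wlam n k lam \<circ> v"
proof -
  have "w ` {1..k} \<subseteq> {1..n}" 
    using assms permutes_in_image[of w "{1..n}"] by (auto simp: Sn_def simp del: One_nat_def)
  moreover have "card (w ` {1..k}) = k" using inj_Sn[OF assms(1)] by (simp add: card_image inj_on_subset)
  ultimately obtain g where g: "g \<in> Sn n" "g ` {1..k} = w ` {1..k}" "strict_mono_on {1..k} g" "strict_mono_on {k+1..n} g"
    using ex_blockwise_ascending[of "w ` {1..k}" n k] assms(2) by metis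
  \<comment> \<open>An increasing integer sequence grows by at least one per step. Starting from 1
    this gives \<open>j \<le> g j\<close>, so the subtraction defining \<open>lam\<close> is exact;
    ending at k it bounds the parts by n - k; in general it makes them weakly decreasing.\<close>
  have gap: "g i + (j - i) \<le> g j" if "i \<le> j" "1 \<le> i" "j \<le> k" for i j
    using that
  proof (induction j rule: dec_induct)
    case (step m)
    have "g m < g (Suc m)" using g(3) step by (intro strict_mono_onD[OF g(3)]) auto
    then show ?case using step by auto
  qed simp
  have rng: "1 \<le> g j \<and> g j \<le> n" if "1 \<le> j" "j \<le> k" for j
    using that g(1) assms(2) permutes_in_image[of g "{1..n}" j] by (auto simp: Sn_def)
  have low: "j \<le> g j" if "1 \<le> j" "j \<le> k" for j
    using gap[of 1 j] rng[of 1] that by auto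
  have high: "g j - j \<le> n - k" if "1 \<le> j" "j \<le> k" for j
    using gap[of j k] rng[of k] low[of j] assms(2) that by auto
  define lam where "lam = map (\<lambda>i. g (k - i) - (k - i)) [0..<k]"
  have "sorted (rev lam)"
    unfolding sorted_rev_iff_nth_mono
  proof (intro allI impI)
    fix i j assume ij: "i \<le> j" "j < length lam"
    then have "g (k - j) + (k - i - (k - j)) \<le> g (k - i)" by (intro gap) (auto simp: lam_def)
    then show "lam ! j \<le> lam ! i" using ij by (simp add: lam_def)
  qed
  moreover have "lam ! i \<le> n - k" if "i < k" for i
    using high[of "k - i"] that by (simp add: lam_def)
  ultimately have lam: "lam \<in> parts n k" by (simp add: parts_def) (simp add: lam_def)
  have "g j = wlam n k lam j" if "j \<in> {1..k}" for j
    using that low[of j] wlam_lower[OF lam assms(2) that] by (simp add: lam_def)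
  then have "g ` {1..k} = wlam n k lam ` {1..k}" by (intro image_cong) auto
  then have gw: "g = wlam n k lam"
    using g lam assms wlam_in_Sn wlam_ascending_lower wlam_ascending_upper
    by (intro blockwise_ascending_unique[of g n "wlam n k lam" k]) auto
  have "(inv g \<circ> w) ` {1..k} = inv g ` g ` {1..k}" using g(2) unfolding image_comp[symmetric] by simp
  also have "\<dots> = {1..k}" using inj_Sn[OF g(1)] by (simp add: image_comp)
  finally have "inv g \<circ> w \<in> young n k"
    using comp_in_Sn[OF inv_in_Sn[OF g(1)] assms(1)] by (simp add: young_def Sn_def)
  moreover have "w = g \<circ> (inv g \<circ> w)" using inv_Sn_apply[OF g(1)] by (simp add: fun_eq_iff)
  ultimately show ?thesis using lam gw by metis
qed

text \<open>The image of the first block determines the Grassmannian factor, whose values there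
  return the partition. Used to turn sums over S_n into sums over partitions and the Young
  subgroup.\<close>

lemma wlam_factorization_bij:
  assumes "k \<le> n"
  shows "bij_betw (\<lambda>(lam, v). wlam n k lam \<circ> v) (parts n k \<times> young n k) (Sn n)"
  unfolding bij_betw_def
proof
  show "inj_on (\<lambda>(lam, v). wlam n k lam \<circ> v) (parts n k \<times> young n k)"
  proof (rule inj_onI, clarify)
    fix lam v mu u
    assume l: "lam \<in> parts n k" and m: "mu \<in> parts n k" and v: "v \<in> young n k" and u: "u \<in> young n k"
      and eq: "wlam n k lam \<circ> v = wlam n k mu \<circ> u"
    have "v ` {1..k} = {1..k}" "u ` {1..k} = {1..k}" using u v by (auto simp: young_def)
    then have "wlam n k lam ` {1..k} = wlam n k mu ` {1..k}"
      using arg_cong[OF eq, of "\<lambda>h. h ` {1..k}"] by (simp only: image_comp[symmetric])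
    then have w: "wlam n k lam = wlam n k mu"
      using l m assms wlam_in_Sn wlam_ascending_lower wlam_ascending_upper
      by (intro blockwise_ascending_unique[of _ n _ k]) auto
    have "lam = mu"
    proof (rule nth_equalityI)
      show "length lam = length mu" using l m by (simp add: parts_def)
      fix i assume "i < length lam"
      then have "k - i \<in> {1..k}" "k - (k - i) = i" using l by (auto simp: parts_def)
      then show "lam ! i = mu ! i"
        using wlam_lower[OF l assms, of "k - i"] wlam_lower[OF m assms, of "k - i"] w by simp
    qed
    moreover have "v = u"
      using eq w inj_Sn[OF wlam_in_Sn[OF m assms]] by (auto simp: fun_eq_iff inj_eq)
    ultimately show "lam = mu \<and> v = u" by simp
  qed
  show "(\<lambda>(lam, v). wlam n k lam \<circ> v) ` (parts n k \<times> young n k) = Sn n" (is "?L = _")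
  proof
    show "?L \<subseteq> Sn n" using wlam_in_Sn[OF _ assms] young_subset_Sn by (auto intro!: comp_in_Sn)
    show "Sn n \<subseteq> ?L" using ex_wlam_factorization[OF _ assms] by (fastforce simp: image_iff)
  qed
qed

subsection \<open>The free algebra and its quotients\<close>

text \<open>With concatenation as addition on words, the convolution product of finitely supported
  functions is the product of the free algebra, so \<open>fa\<close> becomes a ring whose
  multiplication is \<open>fmul\<close>.\<close>

instantiation list :: (type) monoid_add
begin
definition zero_list :: "'a list" where "zero_list = []"
definition plus_list :: "'a list \<Rightarrow> 'a list \<Rightarrow> 'a list" where "plus_list u w = u @ w"
instance by standard (auto simp: zero_list_def plus_list_def)
end

lemma poly_mapping_sum_single:
  fixes a :: "'k \<Rightarrow>\<^sub>0 'b::comm_monoid_add"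
  shows "(\<Sum>u\<in>Poly_Mapping.keys a. Poly_Mapping.single u (Poly_Mapping.lookup a u)) = a"
proof (rule poly_mapping_eqI)
  fix k
  show "Poly_Mapping.lookup (\<Sum>u\<in>Poly_Mapping.keys a. Poly_Mapping.single u (Poly_Mapping.lookup a u)) k
    = Poly_Mapping.lookup a k"
    by (auto simp: lookup_sum lookup_single when_def in_keys_iff)
qed

lemma fmul_eq_times: "fmul a b = a * b"
proof -
  have "a * b = (\<Sum>u\<in>Poly_Mapping.keys a. Poly_Mapping.single u (Poly_Mapping.lookup a u)) *
      (\<Sum>w\<in>Poly_Mapping.keys b. Poly_Mapping.single w (Poly_Mapping.lookup b w))"
    by (simp only: poly_mapping_sum_single)
  then show ?thesis by (simp add: fmul_def sum_product mult_single plus_list_def)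
qed

lemma fone_eq_one: "fone = 1"
  by (simp add: fone_def fconst_def flip: single_one zero_list_def)

lemma fprod_eq_prod_list: "fprod xs = prod_list xs"
  by (induction xs) (simp_all add: fprod_def fmul_eq_times fone_eq_one)

lemma fpow_eq_power: "fpow g j = fgen g ^ j"
  by (induction j) (simp_all add: fpow_def fprod_eq_prod_list)

lemma fcomm_eq: "fcomm a b = a * b - b * a"
  by (simp add: fcomm_def fmul_eq_times)

lemmas fa_ring_simps = fmul_eq_times fone_eq_one fprod_eq_prod_list fpow_eq_power fcomm_eq

lemma single_word: "Poly_Mapping.single u c = fconst c * prod_list (map fgen u)"
proof -
  have "prod_list (map fgen u) = Poly_Mapping.single u 1"
  proof (induction u)
    case Nil
    show ?case by (simp flip: single_one add: zero_list_def)
  qed (simp add: fgen_def mult_single plus_list_def)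
  then show ?thesis by (simp add: fconst_def mult_single plus_list_def)
qed

lemma fconst_commute: "fconst c * a = a * fconst c"
proof -
  have "a * fconst c = (\<Sum>u\<in>Poly_Mapping.keys a. Poly_Mapping.single u (Poly_Mapping.lookup a u)) * fconst c"
    "fconst c * a = fconst c * (\<Sum>u\<in>Poly_Mapping.keys a. Poly_Mapping.single u (Poly_Mapping.lookup a u))"
    by (simp_all only: poly_mapping_sum_single)
  then show ?thesis
    by (simp add: fconst_def sum_distrib_left sum_distrib_right mult_single plus_list_def mult.commute)
qed

lemma lookup_fa_times:
  fixes a b :: fa
  shows "Poly_Mapping.lookup (a * b) x = (\<Sum>u\<in>Poly_Mapping.keys a. \<Sum>w\<in>Poly_Mapping.keys b.
    if u @ w = x then Poly_Mapping.lookup a u * Poly_Mapping.lookup b w else 0)"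
  by (auto simp flip: fmul_eq_times simp: fmul_def lookup_sum lookup_single when_def intro!: sum.cong)

text \<open>The constant coefficient is the augmentation of the free algebra: the empty word factors
  only into empty words.\<close>

lemma lookup_Nil_times [simp]:
  fixes a b :: fa
  shows "Poly_Mapping.lookup (a * b) [] = Poly_Mapping.lookup a [] * Poly_Mapping.lookup b []"
proof -
  have "Poly_Mapping.lookup (a * b) [] = (\<Sum>u\<in>Poly_Mapping.keys a. \<Sum>w\<in>Poly_Mapping.keys b.
     (if u = [] then Poly_Mapping.lookup a u else 0) * (if w = [] then Poly_Mapping.lookup b w else 0))"
    unfolding lookup_fa_times by (intro sum.cong) auto
  also have "\<dots> = (\<Sum>u\<in>Poly_Mapping.keys a. if u = [] then Poly_Mapping.lookup a u else 0) *
    (\<Sum>w\<in>Poly_Mapping.keys b. if w = [] then Poly_Mapping.lookup b w else 0)"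
    by (rule sum_product[symmetric])
  also have "\<dots> = Poly_Mapping.lookup a [] * Poly_Mapping.lookup b []"
    by (simp add: sum.delta in_keys_iff)
  finally show ?thesis .
qed

text \<open>In a factorization of a one-letter word one factor is empty. Hence products in the
  relators contribute nothing at the word [Gc].\<close>

lemma lookup_singleton_times_eq_0:
  fixes a b :: fa
  assumes "Poly_Mapping.lookup a [] = 0" "Poly_Mapping.lookup b [] = 0"
  shows "Poly_Mapping.lookup (a * b) [g] = 0"
  unfolding lookup_fa_times using assms by (intro sum.neutral ballI) (auto simp: append_eq_Cons_conv)

lemma lookup_fgen [simp]:
  "Poly_Mapping.lookup (fgen g) [] = 0" "Poly_Mapping.lookup (fgen g) [h] = (if g = h then 1 else 0)"
  by (simp_all add: fgen_def lookup_single when_def)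

section \<open>Two-sided ideals and congruence modulo them\<close>

lemma fideal_times:
  assumes "x \<in> fideal R"
  shows "c * x \<in> fideal R \<and> x * c \<in> fideal R"
  using assms
proof induction
  case (gen r a b)
  have "c * (a * r * b) = (c * a) * r * b" "a * r * b * c = a * r * (b * c)" by (simp_all add: mult.assoc)
  then show ?case using fideal.gen[OF gen, of "c * a" b] fideal.gen[OF gen, of a "b * c"]
    by (simp add: fmul_eq_times)
next
  case zero
  show ?case by (simp add: fideal.zero)
next
  case (add a b)
  then show ?case by (simp add: distrib_left distrib_right fideal.add)
qed

lemma fideal_uminus: "x \<in> fideal R \<Longrightarrow> - x \<in> fideal R"
  using fideal_times[of x R "-1"] by simp

lemma fideal_base: "r \<in> R \<Longrightarrow> r \<in> fideal R"
  using fideal.gen[of r R 1 1] by (simp add: fmul_eq_times)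

lemma fideal_mono: "R \<subseteq> S \<Longrightarrow> x \<in> fideal R \<Longrightarrow> x \<in> fideal S"
  by (rotate_tac, induction rule: fideal.induct) (auto intro: fideal.intros)

lemma heq_refl: "heq R a a"
  by (simp add: heq_def fideal.zero)

lemma heq_sym: "heq R a b \<Longrightarrow> heq R b a"
  unfolding heq_def using fideal_uminus[of "a - b" R] by simp

lemma heq_trans: "heq R a b \<Longrightarrow> heq R b c \<Longrightarrow> heq R a c"
  unfolding heq_def using fideal.add[of "a - b" R "b - c"] by simp

lemma heq_add: "heq R a b \<Longrightarrow> heq R c d \<Longrightarrow> heq R (a + c) (b + d)"
  unfolding heq_def using fideal.add[of "a - b" R "c - d"] by (simp add: algebra_simps)

lemma heq_uminus: "heq R a b \<Longrightarrow> heq R (- a) (- b)"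
  unfolding heq_def using fideal_uminus[of "a - b" R] by simp

lemma heq_times:
  assumes "heq R a b" "heq R c d"
  shows "heq R (a * c) (b * d)"
proof -
  have "(a - b) * c + b * (c - d) \<in> fideal R"
    using assms fideal_times by (auto simp: heq_def intro!: fideal.add)
  then show ?thesis by (simp add: heq_def algebra_simps)
qed

text \<open>The relations of \<open>\<widehat>H\<^sub>n\<close> together with centrality of \<open>Gc\<close>: they hold both in the
  localized algebra and in every Schubert representation, where \<open>Gc\<close> acts by zero.\<close>

definition rels :: "nat \<Rightarrow> fa set" where
  "rels n = (hrel n - {fgen Gc}) \<union> {fcomm (fgen Gc) (fgen g) | g. True}"

lemma rels_subset_hrel_loc: "rels n \<subseteq> hrel_loc n k"
  by (auto simp: rels_def hrel_loc_def)

text \<open>The relations lie in the augmentation ideal. This keeps 1 out of the ideal they generate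
  and makes the augmentation well defined on the quotient.\<close>

lemma lookup_Nil_rels:
  assumes "r \<in> rels n"
  shows "Poly_Mapping.lookup r [] = 0"
proof -
  have "r \<in> hrel n \<or> (\<exists>g. r = fcomm (fgen Gc) (fgen g))" using assms by (auto simp: rels_def)
  then show ?thesis
    unfolding hrel_def by (auto simp: fa_ring_simps lookup_minus lookup_add)
qed

lemma lookup_Nil_fideal_rels: "x \<in> fideal (rels n) \<Longrightarrow> Poly_Mapping.lookup x [] = 0"
  by (induction rule: fideal.induct) (simp_all add: fmul_eq_times lookup_Nil_rels lookup_add)

\<comment> \<open>Otherwise transfer would also unfold elements of the free algebra into functions.\<close>
lifting_forget poly_mapping.lifting

text \<open>HOL types cannot depend on \<open>n\<close>, so the quotient rings for all \<open>n\<close> are collected in one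
  product ring.\<close>

quotient_type hecke = "nat \<Rightarrow> fa" / "\<lambda>a b. \<forall>n. heq (rels n) (a n) (b n)"
proof (intro equivpI reflpI sympI transpI allI)
  fix a b c :: "nat \<Rightarrow> fa" and n
  show "heq (rels n) (a n) (a n)" by (rule heq_refl)
  show "heq (rels n) (b n) (a n)" if "\<forall>n. heq (rels n) (a n) (b n)"
    using that heq_sym by blast
  show "heq (rels n) (a n) (c n)" if "\<forall>n. heq (rels n) (a n) (b n)" "\<forall>n. heq (rels n) (b n) (c n)"
    using that heq_trans by blast
qed

instantiation hecke :: ring_1
begin
lift_definition zero_hecke :: hecke is "\<lambda>_. 0" .
lift_definition one_hecke :: hecke is "\<lambda>_. 1" .
lift_definition plus_hecke :: "hecke \<Rightarrow> hecke \<Rightarrow> hecke" is "\<lambda>a b n. a n + b n"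
  by (simp add: heq_add)
lift_definition uminus_hecke :: "hecke \<Rightarrow> hecke" is "\<lambda>a n. - a n"
  by (simp add: heq_uminus)
lift_definition minus_hecke :: "hecke \<Rightarrow> hecke \<Rightarrow> hecke" is "\<lambda>a b n. a n - b n"
  using heq_add[OF _ heq_uminus] by simp
lift_definition times_hecke :: "hecke \<Rightarrow> hecke \<Rightarrow> hecke" is "\<lambda>a b n. a n * b n"
  by (simp add: heq_times)
instance
proof
  have "\<not> heq (rels n) 0 1" for n
    using lookup_Nil_fideal_rels[of "- 1" n] lookup_one_zero[where ?'b = "gen list" and ?'a = rat]
    by (auto simp: heq_def zero_list_def)
  then show "(0::hecke) \<noteq> 1" by transfer simp
qed (transfer; simp add: heq_refl algebra_simps)+
end

text \<open>The augmentation in the components \<open>m \<noteq> n\<close> makes this map unital, and it kills all relations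
  there.\<close>

lift_definition hecke_class :: "nat \<Rightarrow> fa \<Rightarrow> hecke" is
  "\<lambda>n a m. if m = n then a else fconst (Poly_Mapping.lookup a [])" .

text \<open>In the components other than n only augmentations are compared, and these agree as soon
  as the n-th components are congruent.\<close>

lemma hecke_class_eq_iff: "hecke_class n a = hecke_class n b \<longleftrightarrow> heq (rels n) a b"
proof -
  have "heq (rels n) a b \<Longrightarrow> Poly_Mapping.lookup a [] = Poly_Mapping.lookup b []"
    using lookup_Nil_fideal_rels[of "a - b" n] by (simp add: heq_def lookup_minus)
  then show ?thesis by transfer (auto simp: heq_refl)
qed

locale hecke_hom =
  fixes n :: nat and \<phi> :: "fa \<Rightarrow> 'a::ring_1"
  assumes add: "\<phi> (a + b) = \<phi> a + \<phi> b"
    and mult: "\<phi> (a * b) = \<phi> a * \<phi> b"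
    and one: "\<phi> 1 = 1"
    and rel: "r \<in> rels n \<Longrightarrow> \<phi> r = 0"

lemma hecke_hom_hecke_class: "hecke_hom n (hecke_class n)"
proof
  have "fconst (x + y) = fconst x + fconst y" "fconst (x * y) = fconst x * fconst y" for x y
    by (simp_all add: fconst_def single_add mult_single plus_list_def)
  then show "hecke_class n (a + b) = hecke_class n a + hecke_class n b"
    "hecke_class n (a * b) = hecke_class n a * hecke_class n b" for a b
    by (transfer; auto simp: lookup_add heq_refl)+
  show "hecke_class n 1 = 1"
    by transfer (auto simp: heq_refl lookup_one zero_list_def fone_def[symmetric] fone_eq_one)
  show "hecke_class n r = 0" if "r \<in> rels n" for r
    using that lookup_Nil_rels[OF that]
    by transfer (auto simp: heq_def fideal_base fconst_def fideal.zero)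
qed

subsection \<open>Relations among the generators\<close>

text \<open>After expansion and use of the quadratic relations, everything besides a b a is
  symmetric in a and b. With c = p - q and d = pq this passes the braid relation from T_i to the
  barred T_i.\<close>

lemma braid_shift:
  fixes a b c d :: "'a::ring"
  assumes "c * a = a * c" "c * b = b * c" "a * a = d - c * a" "b * b = d - c * b" "a * b * a = b * a * b"
  shows "(a + c) * (b + c) * (a + c) = (b + c) * (a + c) * (b + c)"
proof -
  have *: "(a + c) * (b + c) * (a + c) = a * b * a + c * (a * b + b * a) + c * d + c * c * (a + b) + c * c * c"
    if h: "c * a = a * c" "c * b = b * c" "a * a = d - c * a" for a b
  proof -
    have "(a + c) * (b + c) * (a + c) =
      a * b * a + a * b * c + a * c * a + a * c * c + c * b * a + c * b * c + c * c * a + c * c * c"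
      by (simp add: algebra_simps)
    moreover have "a * b * c = c * (a * b)" "a * c * a = c * d - c * c * a" "a * c * c = c * c * a" "c * b * c = c * c * b"
      by (metis h(1,2) mult.assoc, metis h(1,3) mult.assoc right_diff_distrib, metis h(1) mult.assoc,
          metis h(2) mult.assoc)
    ultimately show ?thesis by (simp add: algebra_simps)
  qed
  show ?thesis unfolding *[OF assms(1,2,3)] *[OF assms(2,1,4)] assms(5) by (simp add: add.commute)
qed

text \<open>Serves the two symmetrization arguments, where \<open>h\<close> multiplies by s_i on the
  left or on the right and \<open>Q\<close> picks the shorter element of each orbit.\<close>

lemma sum_involution:
  fixes F :: "'b \<Rightarrow> 'c::comm_monoid_add"
  assumes "finite S" "\<And>v. v \<in> S \<Longrightarrow> h v \<in> S" "\<And>v. v \<in> S \<Longrightarrow> h (h v) = v" "\<And>v. v \<in> S \<Longrightarrow> Q (h v) \<longleftrightarrow> \<not> Q v"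
  shows "sum F S = (\<Sum>v\<in>{v\<in>S. Q v}. F v + F (h v))"
proof -
  have "sum F S = sum F {v\<in>S. Q v} + sum F {v\<in>S. \<not> Q v}"
    using assms(1) by (subst sum.union_disjoint[symmetric]) (auto intro: sum.cong)
  also have "sum F {v\<in>S. \<not> Q v} = (\<Sum>v\<in>{v\<in>S. Q v}. F (h v))"
    by (rule sum.reindex_bij_witness[of _ h h]) (use assms in auto)
  finally show ?thesis by (simp add: sum.distrib)
qed

lemma prod_list_commuting_mset:
  fixes G :: "'b \<Rightarrow> 'c::monoid_mult"
  assumes "mset u = mset w" "\<And>g h. g \<in> set u \<Longrightarrow> h \<in> set u \<Longrightarrow> G g * G h = G h * G g"
  shows "prod_list (map G u) = prod_list (map G w)"
proof -
  have fold_eq: "prod_list (map G v) = fold (\<lambda>g a. a * G g) v 1" for v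
    by (induction v rule: rev_induct) simp_all
  have "fold (\<lambda>g a. a * G g) u = fold (\<lambda>g a. a * G g) w"
    by (rule fold_multiset_equiv) (use assms in \<open>auto simp: fun_eq_iff mult.assoc\<close>)
  then show ?thesis by (simp add: fold_eq)
qed

subsection \<open>Monomials\<close>

text \<open>Records a monomial free of the order in which \<open>mono_word\<close> arbitrarily lists
  its letters.\<close>

definition mono_mset :: "('b \<Rightarrow>\<^sub>0 nat) \<Rightarrow> 'b multiset" where
  "mono_mset m = (\<Sum>v\<in>Poly_Mapping.keys m. replicate_mset (Poly_Mapping.lookup m v) v)"

lemma mono_mset_add: "mono_mset (m + m') = mono_mset m + mono_mset m'"
  unfolding mono_mset_def by (rule setsum_keys_plus_distrib) (simp_all add: multiset_eq_iff)

lemma mono_mset_0 [simp]: "mono_mset 0 = {#}"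
  by (simp add: mono_mset_def)

lemma mono_mset_single [simp]: "mono_mset (Poly_Mapping.single v c) = replicate_mset c v"
  by (cases "c = 0") (simp_all add: mono_mset_def)

lemma mono_mset_sum: "mono_mset (sum F S) = (\<Sum>v\<in>S. mono_mset (F v))"
  by (induction S rule: infinite_finite_induct) (simp_all add: mono_mset_add)

lemma mset_mono_word: "mset (mono_word m) = mono_mset m"
proof -
  let ?xs = "SOME xs. distinct xs \<and> set xs = Poly_Mapping.keys m"
  have "\<exists>xs. distinct xs \<and> set xs = Poly_Mapping.keys m"
    using finite_distinct_list[OF finite_keys[of m]] by metis
  from someI_ex[OF this] have xs: "distinct ?xs" "set ?xs = Poly_Mapping.keys m" by auto
  have "mset (concat (map (\<lambda>v. replicate (Poly_Mapping.lookup m v) v) xs))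
    = sum_list (map (\<lambda>v. replicate_mset (Poly_Mapping.lookup m v) v) xs)" for xs
    by (induction xs) simp_all
  then show ?thesis
    unfolding mono_word_def mono_mset_def using xs by (simp add: sum_list_distinct_conv_sum_set)
qed

lemma set_mono_word: "set (mono_word m) = Poly_Mapping.keys m"
proof -
  have "set (mono_word m) = set_mset (mono_mset m)" by (metis mset_mono_word set_mset_mset)
  also have "\<dots> = Poly_Mapping.keys m"
    by (auto simp: mono_mset_def set_mset_sum in_keys_iff)
  finally show ?thesis .
qed

definition poly_letter :: "nat \<Rightarrow> gen \<Rightarrow> bool" where
  "poly_letter n g \<longleftrightarrow> scal_gen g \<or> (\<exists>i. g = GX i \<and> 1 \<le> i \<and> i \<le> n)"

lemma is_Ahx_iff: "is_Ahx n f \<longleftrightarrow> (\<forall>m\<in>Poly_Mapping.keys f. \<forall>v\<in>Poly_Mapping.keys m. poly_letter n v)"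
  by (simp add: is_Ahx_def poly_letter_def)

lemma is_Ahx_0: "is_Ahx n 0"
  by (simp add: is_Ahx_def)

lemma is_Ahx_add: "is_Ahx n f \<Longrightarrow> is_Ahx n g \<Longrightarrow> is_Ahx n (f + g)"
  unfolding is_Ahx_def using keys_add[of f g] by blast

lemma mp_to_fa_0: "mp_to_fa 0 = 0"
  by (simp add: mp_to_fa_def)

lemma mp_to_fa_add: "mp_to_fa (f + g) = mp_to_fa f + mp_to_fa g"
  unfolding mp_to_fa_def by (rule setsum_keys_plus_distrib) (simp_all add: single_add)

lemma mp_to_fa_single: "mp_to_fa (Poly_Mapping.single m c) = Poly_Mapping.single (mono_word m) c"
  by (cases "c = 0") (simp_all add: mp_to_fa_def)

lemma mp_to_fa_sum: "mp_to_fa (sum F S) = (\<Sum>v\<in>S. mp_to_fa (F v))"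
  by (induction S rule: infinite_finite_induct) (simp_all add: mp_to_fa_add mp_to_fa_0)

section \<open>The defining relations as equations in the target ring\<close>

context hecke_hom
begin

abbreviation G :: "gen \<Rightarrow> 'a" where "G g \<equiv> \<phi> (fgen g)"
abbreviation p where "p \<equiv> G Gp"
abbreviation q where "q \<equiv> G Gq"
abbreviation T :: "nat \<Rightarrow> 'a" where "T i \<equiv> G (GT i)"
abbreviation x :: "nat \<Rightarrow> 'a" where "x i \<equiv> G (GX i)"
abbreviation B :: "nat \<Rightarrow> 'a" where "B i \<equiv> \<phi> (Tbar_i i)"

lemma zero: "\<phi> 0 = 0"
  using add[of 0 0] by simp

lemma uminus: "\<phi> (- a) = - \<phi> a"
  using add[of a "- a"] zero by (simp add: eq_neg_iff_add_eq_0 add.commute)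

lemma diff: "\<phi> (a - b) = \<phi> a - \<phi> b"
  using add[of a "- b"] uminus by simp

lemma hom_sum: "\<phi> (sum F S) = (\<Sum>v\<in>S. \<phi> (F v))"
  by (induction S rule: infinite_finite_induct) (simp_all add: add zero)

lemma hom_prod_list: "\<phi> (prod_list us) = prod_list (map \<phi> us)"
  by (induction us) (simp_all add: mult one)

lemma hom_power: "\<phi> (a ^ j) = \<phi> a ^ j"
  by (induction j) (simp_all add: mult one)

lemma hom_fprod: "\<phi> (fprod (map F us)) = prod_list (map (\<lambda>i. \<phi> (F i)) us)"
  by (simp add: fprod_eq_prod_list hom_prod_list comp_def)

lemmas hom_simps = add mult one zero diff uminus hom_sum hom_power

lemma B_eq: "B i = T i + (p - q)"
  by (simp add: Tbar_i_def hom_simps)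

text \<open>The relator \<open>fgen Gc\<close> is the one that \<open>rels n\<close> drops from
  \<open>hrel n\<close>. A vanishing coefficient at the word [Gc] certifies that a given relator is
  a different one.\<close>

lemma hrel_eq_0:
  assumes "r \<in> hrel n" "Poly_Mapping.lookup r [Gc] = 0"
  shows "\<phi> r = 0"
proof -
  have "r \<noteq> fgen Gc" using assms(2) by auto
  then show ?thesis using assms(1) rel by (auto simp: rels_def)
qed

lemma single_hom: "\<phi> (Poly_Mapping.single u c) = \<phi> (fconst c) * prod_list (map G u)"
  by (simp add: single_word hom_simps hom_prod_list comp_def)

lemma const_central: "\<phi> (fconst c) * \<phi> a = \<phi> a * \<phi> (fconst c)"
  using fconst_commute[of c a] by (metis mult)

lemma gen_central:
  assumes "scal_gen s \<or> s = Gc"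
  shows "G s * G g = G g * G s"
proof -
  have "\<phi> (fcomm (fgen s) (fgen g)) = 0"
  proof (cases "s = Gc")
    case True
    then show ?thesis by (intro rel) (auto simp: rels_def)
  next
    case False
    show ?thesis
    proof (rule hrel_eq_0)
      show "fcomm (fgen s) (fgen g) \<in> hrel n" using assms False unfolding hrel_def Un_iff mem_Collect_eq by blast
    qed (simp add: fcomm_eq lookup_minus lookup_singleton_times_eq_0)
  qed
  then show ?thesis by (simp add: fcomm_eq hom_simps)
qed

lemma central:
  assumes "scal_gen s \<or> s = Gc"
  shows "G s * \<phi> a = \<phi> a * G s"
proof -
  have w: "G s * prod_list (map G u) = prod_list (map G u) * G s" for u
    by (induction u) (simp_all add: gen_central[OF assms] mult.assoc flip: mult.assoc[of "G s"])
  have "G s * \<phi> (Poly_Mapping.single u c) = \<phi> (Poly_Mapping.single u c) * G s" for u c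
    using w[of u] const_central[of c "fgen s"] by (metis single_hom mult.assoc)
  then have "G s * \<phi> (\<Sum>u\<in>Poly_Mapping.keys a. Poly_Mapping.single u (Poly_Mapping.lookup a u))
    = \<phi> (\<Sum>u\<in>Poly_Mapping.keys a. Poly_Mapping.single u (Poly_Mapping.lookup a u)) * G s"
    by (simp add: hom_sum sum_distrib_left sum_distrib_right)
  then show ?thesis by (simp add: poly_mapping_sum_single)
qed

lemma p_central: "p * \<phi> a = \<phi> a * p" and q_central: "q * \<phi> a = \<phi> a * q"
  by (simp_all add: central scal_gen_def)

lemma quad:
  assumes "1 \<le> i" "i < n"
  shows "T i * T i = p * q - (p - q) * T i"
proof -
  have "\<phi> (fmul (fgen (GT i) + fgen Gp) (fgen (GT i) - fgen Gq)) = 0"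
  proof (rule hrel_eq_0)
    show "fmul (fgen (GT i) + fgen Gp) (fgen (GT i) - fgen Gq) \<in> hrel n"
      unfolding hrel_def Un_iff mem_Collect_eq using assms by blast
  qed (simp add: fmul_eq_times lookup_add lookup_minus lookup_singleton_times_eq_0)
  then show ?thesis using q_central[of "fgen (GT i)"] by (simp add: fmul_eq_times hom_simps algebra_simps)
qed

lemma T_comm:
  assumes "1 \<le> i" "Suc i < j" "j < n"
  shows "T i * T j = T j * T i"
proof -
  have assms': "1 \<le> i" "i < n" "1 \<le> j" "j < n" "Suc i < j" using assms by auto
  have "\<phi> (fcomm (fgen (GT i)) (fgen (GT j))) = 0"
  proof (rule hrel_eq_0)
    show "fcomm (fgen (GT i)) (fgen (GT j)) \<in> hrel n" unfolding hrel_def Un_iff mem_Collect_eq using assms' by blast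
  qed (simp add: fcomm_eq lookup_minus lookup_singleton_times_eq_0)
  then show ?thesis by (simp add: fcomm_eq hom_simps)
qed

lemma T_braid:
  assumes "1 \<le> i" "Suc i < n"
  shows "T i * T (Suc i) * T i = T (Suc i) * T i * T (Suc i)"
proof -
  have "\<phi> (fprod [fgen (GT i), fgen (GT (Suc i)), fgen (GT i)]
        - fprod [fgen (GT (Suc i)), fgen (GT i), fgen (GT (Suc i))]) = 0" (is "\<phi> ?r = 0")
  proof (rule hrel_eq_0)
    show "?r \<in> hrel n" unfolding hrel_def Un_iff mem_Collect_eq using assms by blast
  qed (simp add: fprod_eq_prod_list lookup_minus lookup_singleton_times_eq_0)
  then show ?thesis by (simp add: fprod_eq_prod_list hom_simps mult.assoc)
qed

lemma T_x_far:
  assumes "1 \<le> i" "i < n" "1 \<le> j" "j \<le> n" "j \<noteq> i" "j \<noteq> Suc i"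
  shows "T i * x j = x j * T i"
proof -
  have "\<phi> (fcomm (fgen (GT i)) (fgen (GX j))) = 0"
  proof (rule hrel_eq_0)
    show "fcomm (fgen (GT i)) (fgen (GX j)) \<in> hrel n" unfolding hrel_def Un_iff mem_Collect_eq using assms by blast
  qed (simp add: fcomm_eq lookup_minus lookup_singleton_times_eq_0)
  then show ?thesis by (simp add: fcomm_eq hom_simps)
qed

lemma x_comm:
  assumes "1 \<le> i" "i \<le> n" "1 \<le> j" "j \<le> n"
  shows "x i * x j = x j * x i"
proof -
  have "\<phi> (fcomm (fgen (GX i)) (fgen (GX j))) = 0"
  proof (rule hrel_eq_0)
    show "fcomm (fgen (GX i)) (fgen (GX j)) \<in> hrel n" unfolding hrel_def Un_iff mem_Collect_eq using assms by blast
  qed (simp add: fcomm_eq lookup_minus lookup_singleton_times_eq_0)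
  then show ?thesis by (simp add: fcomm_eq hom_simps)
qed

lemma T_x:
  assumes "1 \<le> i" "i < n"
  shows "T i * x i = x (Suc i) * T i + (G Gh - (p - q) * x i)"
proof -
  have "\<phi> (fmul (fgen (GT i)) (fgen (GX i))
        - (fmul (fgen (GX (Suc i))) (fgen (GT i))
           + (fgen Gh - fmul (fgen Gp - fgen Gq) (fgen (GX i))))) = 0" (is "\<phi> ?r = 0")
  proof (rule hrel_eq_0)
    show "?r \<in> hrel n" unfolding hrel_def Un_iff mem_Collect_eq using assms by blast
  qed (simp add: fmul_eq_times lookup_minus lookup_add lookup_singleton_times_eq_0)
  then show ?thesis by (simp add: fmul_eq_times hom_simps)
qed

lemma T_x_Suc:
  assumes "1 \<le> i" "i < n"
  shows "T i * x (Suc i) = x i * T i - (G Gh - (p - q) * x i)"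
proof -
  have "\<phi> (fmul (fgen (GT i)) (fgen (GX (Suc i)))
        - (fmul (fgen (GX i)) (fgen (GT i))
           - (fgen Gh - fmul (fgen Gp - fgen Gq) (fgen (GX i))))) = 0" (is "\<phi> ?r = 0")
  proof (rule hrel_eq_0)
    show "?r \<in> hrel n" unfolding hrel_def Un_iff mem_Collect_eq using assms by blast
  qed (simp add: fmul_eq_times lookup_minus lookup_add lookup_singleton_times_eq_0)
  then show ?thesis by (simp add: fmul_eq_times hom_simps)
qed

lemma c_central: "(p - q) * \<phi> a = \<phi> a * (p - q)"
  by (simp add: algebra_simps p_central q_central)

text \<open>This is (X - p)(X + q) = 0 for X = \<open>B i\<close>: the shift by p - q moves the
  roots -p and q of the relation for T_i to -q and p.\<close>

lemma B_quad:
  assumes "1 \<le> i" "i < n"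
  shows "B i * B i = (p - q) * B i + p * q"
proof -
  have "B i * B i = T i * T i + T i * (p - q) + (p - q) * T i + (p - q) * (p - q)"
    by (simp add: B_eq distrib_left distrib_right)
  also have "\<dots> = (p - q) * (T i + (p - q)) + p * q"
    using quad[OF assms] c_central[of "fgen (GT i)"] by (simp add: distrib_left)
  finally show ?thesis by (simp add: B_eq)
qed

text \<open>Up to the scalar pq the barred generator is inverse to T_i; this computes its action on
  Schubert classes at an ascent.\<close>

lemma B_T:
  assumes "1 \<le> i" "i < n"
  shows "B i * T i = p * q"
  using quad[OF assms] by (simp add: B_eq distrib_right)

sublocale TF: braid_family n T
  by standard (auto intro: T_comm T_braid)

sublocale BF: braid_family n B
proof
  fix i j assume "1 \<le> i" "Suc i < j" "j < n"
  then show "B i * B j = B j * B i"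
    using T_comm[of i j] c_central[of "fgen (GT i)"] c_central[of "fgen (GT j)"]
    by (simp add: B_eq distrib_left distrib_right)
next
  fix i assume "1 \<le> i" "Suc i < n"
  then show "B i * B (Suc i) * B i = B (Suc i) * B i * B (Suc i)"
    unfolding B_eq using quad[of i] quad[of "Suc i"] T_braid[of i]
    by (intro braid_shift[where d = "p * q"] c_central) auto
qed

lemma Tw_hom: "\<phi> (Tw n w) = wprod n T w"
  by (simp add: Tw_def wprod_def hom_fprod)

lemma Tbarw_hom: "\<phi> (Tbarw n w) = wprod n B w"
  by (simp add: Tbarw_def wprod_def hom_fprod)

abbreviation W :: "(nat \<Rightarrow> nat) \<Rightarrow> 'a" where "W \<equiv> wprod n B"

lemma W_descent:
  assumes "w \<in> Sn n" "1 \<le> i" "i < n" "w (Suc i) < w i"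
  shows "W w * B i = W w * (p - q) + W (w \<circ> adj i) * (p * q)"
proof -
  let ?u = "w \<circ> adj i"
  have "W (?u \<circ> adj i) = W ?u * B i"
    using assms by (intro BF.wprod_ascent comp_in_Sn adj_in_Sn) auto
  then have W: "W w = W ?u * B i" by simp
  then have "W w * B i = W ?u * (B i * B i)" by (simp add: mult.assoc)
  also have "\<dots> = W ?u * B i * (p - q) + W ?u * (p * q)"
    using B_quad[OF assms(2,3)] by (simp add: distrib_left c_central mult.assoc)
  finally show ?thesis using W by simp
qed

end

subsection \<open>Polynomials in the Hecke algebra\<close>

lemma gen_rename_GX: "gen_rename s (GX i) = GX (s i)"
  by (simp add: gen_rename_def)

lemma image_mset_sum: "image_mset f (sum F S) = (\<Sum>v\<in>S. image_mset f (F v))"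
  by (induction S rule: infinite_finite_induct) simp_all

text \<open>Inductive step for the commutation of \<open>t = T\<^sub>i\<close> with a monomial \<open>w\<close>, where \<open>w' = s\<^sub>i w\<close> and
  \<open>d = (w - w') / (x - x')\<close> is the divided difference, characterized without division.\<close>

lemma twisted_leibniz_step:
  fixes x x' r t w w' d :: "'a::ring"
  assumes "x * x' = x' * x" "r * x = x * r" "r * x' = x' * r"
    and "w - w' = (x - x') * d" "t * w = w' * t + r * d" "t * w' = w * t - r * d"
    and "t * x = x' * t + r" "t * x' = x * t - r"
  shows "x * w - x' * w' = (x - x') * (x' * d + w)"
    and "t * (x * w) = x' * w' * t + r * (x' * d + w)"
    and "t * (x' * w') = x * w * t - r * (x' * d + w)"
proof -
  have w: "w = w' + x * d - x' * d" using assms(4) by (simp add: algebra_simps)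
  have "x' * (x * d) = x * (x' * d)" using assms(1) by (metis mult.assoc)
  then show "x * w - x' * w' = (x - x') * (x' * d + w)"
    by (simp add: w algebra_simps)
  have "t * (x * w) = x' * (t * w) + r * w" using assms(7) by (metis mult.assoc distrib_right)
  also have "\<dots> = x' * w' * t + x' * r * d + r * w" unfolding assms(5) by (simp add: algebra_simps)
  finally show "t * (x * w) = x' * w' * t + r * (x' * d + w)"
    using assms(3) by (metis add.assoc distrib_left mult.assoc)
  have "t * (x' * w') = x * (t * w') - r * w'" using assms(8) by (metis mult.assoc left_diff_distrib)
  also have "\<dots> = x * w * t - (x * r * d + r * w')" unfolding assms(6) by (simp add: algebra_simps)
  also have "x * r * d + r * w' = r * (x' * d + w)"
    using assms(2) by (simp add: w algebra_simps flip: mult.assoc)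
  finally show "t * (x' * w') = x * w * t - r * (x' * d + w)" .
qed

text \<open>Prefixing x' in place of x: the roles of x and x' are exchanged, with r and d negated so
  that the hypotheses keep their form.\<close>

lemma twisted_leibniz_step':
  fixes x x' r t w w' d :: "'a::ring"
  assumes "x * x' = x' * x" "r * x = x * r" "r * x' = x' * r"
    and "w - w' = (x - x') * d" "t * w = w' * t + r * d" "t * w' = w * t - r * d"
    and "t * x = x' * t + r" "t * x' = x * t - r"
  shows "x' * w - x * w' = (x - x') * (x * d - w)"
    and "t * (x' * w) = x * w' * t + r * (x * d - w)"
    and "t * (x * w') = x' * w * t - r * (x * d - w)"
proof -
  have "w - w' = (x' - x) * (- d)" "t * w = w' * t + (- r) * (- d)" "t * w' = w * t - (- r) * (- d)"
    "t * x' = x * t + (- r)" "t * x = x' * t - (- r)" "(- r) * x' = x' * (- r)" "(- r) * x = x * (- r)"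
    using assms by (simp_all add: left_diff_distrib)
  note s = twisted_leibniz_step[of x' x "- r" w w' "- d" t, OF assms(1)[symmetric] this(6,7,1,2,3,4,5)]
  show "x' * w - x * w' = (x - x') * (x * d - w)" using s(1) by (simp add: algebra_simps)
  show "t * (x' * w) = x * w' * t + r * (x * d - w)" using s(2) by (simp add: algebra_simps)
  show "t * (x * w') = x' * w * t - r * (x * d - w)" using s(3) by (simp add: algebra_simps)
qed

section \<open>The polynomial subring and its commutation with the generators\<close>

context hecke_hom
begin

abbreviation M :: "mpoly \<Rightarrow> 'a" where "M f \<equiv> \<phi> (mp_to_fa f)"
abbreviation Wd :: "gen list \<Rightarrow> 'a" where "Wd u \<equiv> prod_list (map G u)"

definition polys :: "'a set" where "polys = M ` {f. is_Ahx n f}"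

lemma M_eq: "M f = (\<Sum>m\<in>Poly_Mapping.keys f. \<phi> (fconst (Poly_Mapping.lookup f m)) * Wd (mono_word m))"
  by (simp add: mp_to_fa_def hom_sum single_hom)

lemma letters_commute:
  assumes "poly_letter n g" "poly_letter n h"
  shows "G g * G h = G h * G g"
  using assms gen_central[of g h] gen_central[of h g] x_comm unfolding poly_letter_def by metis

lemma Wd_mset_cong:
  assumes "mset u = mset w" "\<And>g. g \<in> set u \<Longrightarrow> poly_letter n g"
  shows "Wd u = Wd w"
  using assms letters_commute by (intro prod_list_commuting_mset) auto

lemma polys_0: "0 \<in> polys"
  unfolding polys_def using is_Ahx_0 mp_to_fa_0 zero by force

lemma polys_add: "a \<in> polys \<Longrightarrow> b \<in> polys \<Longrightarrow> a + b \<in> polys"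
  unfolding polys_def using is_Ahx_add by (auto simp flip: add mp_to_fa_add)

lemma polys_sum: "(\<And>v. v \<in> S \<Longrightarrow> F v \<in> polys) \<Longrightarrow> sum F S \<in> polys"
  by (induction S rule: infinite_finite_induct) (auto intro: polys_0 polys_add)

lemma polys_word:
  assumes "\<And>g. g \<in> set u \<Longrightarrow> poly_letter n g"
  shows "\<phi> (fconst c) * Wd u \<in> polys"
proof -
  define m where "m = sum_list (map (\<lambda>g. Poly_Mapping.single g (1::nat)) u)"
  have "mono_mset m = mset u" unfolding m_def by (induction u) (simp_all add: mono_mset_add)
  then have ms: "mset (mono_word m) = mset u" by (simp add: mset_mono_word)
  then have "set (mono_word m) = set u" by (metis set_mset_mset)
  then have "is_Ahx n (Poly_Mapping.single m c)"
    using assms by (auto simp: is_Ahx_iff set_mono_word)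
  moreover have "M (Poly_Mapping.single m c) = \<phi> (fconst c) * Wd u"
    using Wd_mset_cong[OF ms[symmetric] assms] by (simp add: mp_to_fa_single single_hom)
  ultimately show ?thesis unfolding polys_def by force
qed

text \<open>Forgets that the words are ordered monomials: arbitrary words in polynomial letters are
  what an induction on letters can handle.\<close>

lemma polysE:
  assumes "a \<in> polys"
  obtains S :: "gen list set" and c where "finite S" "\<And>u g. u \<in> S \<Longrightarrow> g \<in> set u \<Longrightarrow> poly_letter n g"
    "a = (\<Sum>u\<in>S. \<phi> (fconst (c u)) * Wd u)"
proof -
  obtain f where f: "is_Ahx n f" "a = M f" using assms by (auto simp: polys_def)
  have inj: "inj_on mono_word (Poly_Mapping.keys f)"
  proof (rule inj_onI)
    fix m m' assume "mono_word m = mono_word m'"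
    then have "mono_mset m = mono_mset m'" by (metis mset_mono_word)
    moreover have "count (mono_mset m) v = Poly_Mapping.lookup m v" for m :: "gen \<Rightarrow>\<^sub>0 nat" and v
      by (auto simp: mono_mset_def count_sum in_keys_iff)
    ultimately show "m = m'" by (metis poly_mapping_eqI)
  qed
  show thesis
  proof
    show "finite (mono_word ` Poly_Mapping.keys f)" by simp
    show "poly_letter n g" if "u \<in> mono_word ` Poly_Mapping.keys f" "g \<in> set u" for u g
      using that f by (auto simp: is_Ahx_iff set_mono_word)
    show "a = (\<Sum>u\<in>mono_word ` Poly_Mapping.keys f.
        \<phi> (fconst (Poly_Mapping.lookup f (the_inv_into (Poly_Mapping.keys f) mono_word u))) * Wd u)"
      using inj by (simp add: f M_eq sum.reindex the_inv_into_f_f)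
  qed
qed

lemma const_left_commute: "\<phi> a * (\<phi> (fconst c) * z) = \<phi> (fconst c) * (\<phi> a * z)"
  by (simp add: const_central flip: mult.assoc)

lemma const_hom_mult: "\<phi> (fconst (c * d)) = \<phi> (fconst c) * \<phi> (fconst d)"
  by (simp add: fconst_def mult_single plus_list_def flip: mult)

lemma polys_mult:
  assumes "a \<in> polys" "b \<in> polys"
  shows "a * b \<in> polys"
proof -
  obtain S c where S: "\<And>u g. u \<in> S \<Longrightarrow> g \<in> set u \<Longrightarrow> poly_letter n g"
    "a = (\<Sum>u\<in>S. \<phi> (fconst (c u)) * Wd u)" using polysE[OF assms(1)] by metis
  obtain R d where R: "\<And>u g. u \<in> R \<Longrightarrow> g \<in> set u \<Longrightarrow> poly_letter n g"
    "b = (\<Sum>u\<in>R. \<phi> (fconst (d u)) * Wd u)" using polysE[OF assms(2)] by metis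
  have "\<phi> (fconst (c u)) * Wd u * (\<phi> (fconst (d w)) * Wd w) = \<phi> (fconst (c u * d w)) * Wd (u @ w)" for u w
    using const_central[of "d w" "prod_list (map fgen u)"]
    by (simp add: const_hom_mult hom_prod_list comp_def mult.assoc) (simp flip: mult.assoc)
  then have "a * b = (\<Sum>u\<in>S. \<Sum>w\<in>R. \<phi> (fconst (c u * d w)) * Wd (u @ w))"
    by (simp only: S(2) R(2) sum_product)
  also have "\<dots> \<in> polys" by (intro polys_sum polys_word) (use S(1) R(1) in auto)
  finally show ?thesis .
qed

lemma const_1: "\<phi> (fconst 1) = 1"
  using one by (simp flip: fone_def add: fone_eq_one)

lemma polys_1: "1 \<in> polys"
  using polys_word[of "[]" 1] by (simp add: const_1)

lemma polys_letter: "poly_letter n g \<Longrightarrow> G g \<in> polys"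
  using polys_word[of "[g]" 1] by (simp add: const_1)

lemma polys_const: "\<phi> (fconst c) \<in> polys"
  using polys_word[of "[]" c] by simp

lemma polys_uminus:
  assumes "a \<in> polys"
  shows "- a \<in> polys"
proof -
  have "fconst (- 1) = - 1" by (simp add: fconst_def single_uminus flip: zero_list_def)
  then have "\<phi> (fconst (- 1)) * a = - a" by (simp add: hom_simps)
  then show ?thesis using polys_mult[OF polys_const assms] by metis
qed

lemma polys_diff: "a \<in> polys \<Longrightarrow> b \<in> polys \<Longrightarrow> a - b \<in> polys"
  using polys_add[of a "- b"] polys_uminus by simp

lemma polys_power: "a \<in> polys \<Longrightarrow> a ^ j \<in> polys"
  by (induction j) (auto intro: polys_1 polys_mult)

lemma polys_p: "p \<in> polys" and polys_q: "q \<in> polys" and polys_h: "G Gh \<in> polys"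
  by (auto intro!: polys_letter simp: poly_letter_def scal_gen_def)

lemma polys_x: "1 \<le> i \<Longrightarrow> i \<le> n \<Longrightarrow> x i \<in> polys"
  by (auto intro!: polys_letter simp: poly_letter_def)

lemmas polys_intros = polys_0 polys_1 polys_add polys_diff polys_mult polys_power polys_p polys_q polys_h polys_x

text \<open>Here d is the divided difference of the word. The three clauses are proved together
  because each new letter feeds all of them into the twisted Leibniz steps; letters other than x_i
  and x_(i+1) commute with everything involved and simply multiply d.\<close>

lemma Wd_rename_eq:
  assumes "1 \<le> i" "i < n" "\<And>g. g \<in> set u \<Longrightarrow> poly_letter n g"
  shows "\<exists>d\<in>polys. Wd u - Wd (map (gen_rename (adj i)) u) = (x i - x (Suc i)) * d
    \<and> T i * Wd u = Wd (map (gen_rename (adj i)) u) * T i + (G Gh - (p - q) * x i) * d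
    \<and> T i * Wd (map (gen_rename (adj i)) u) = Wd u * T i - (G Gh - (p - q) * x i) * d"
  using assms(3)
proof (induction u)
  case Nil
  show ?case by (intro bexI[of _ 0]) (simp_all add: polys_0)
next
  case (Cons g u)
  let ?r = "G Gh - (p - q) * x i" and ?w = "Wd u" and ?w' = "Wd (map (gen_rename (adj i)) u)"
  obtain d where d: "d \<in> polys" "?w - ?w' = (x i - x (Suc i)) * d"
    "T i * ?w = ?w' * T i + ?r * d" "T i * ?w' = ?w * T i - ?r * d"
    using Cons by auto
  have wp: "?w \<in> polys" using polys_word[of u 1] Cons.prems by (simp add: const_1)
  have xx: "x i * x (Suc i) = x (Suc i) * x i" using assms by (intro x_comm) auto
  have rx: "?r * x j = x j * ?r" if "1 \<le> j" "j \<le> n" for j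
  proof -
    have "G Gh * x j = x j * G Gh" "(p - q) * x i * x j = x j * ((p - q) * x i)"
      using gen_central[of Gh "GX j"] x_comm[of i j] c_central[of "fgen (GX j)"] assms that
      by (simp add: scal_gen_def) (metis x_comm[of i j] assms that less_imp_le mult.assoc c_central)
    then show ?thesis by (simp add: left_diff_distrib right_diff_distrib)
  qed
  note pre = xx rx[of i] rx[of "Suc i"] d(2,3,4) T_x[OF assms(1,2)] T_x_Suc[OF assms(1,2)]
  consider "g = GX i" | "g = GX (Suc i)" | "gen_rename (adj i) g = g" "T i * G g = G g * T i" "G g * x i = x i * G g"
      "G g * x (Suc i) = x (Suc i) * G g" "G g * ?r = ?r * G g"
  proof -
    have "poly_letter n g" using Cons.prems by simp
    then consider (scalar) "scal_gen g" | (var) j where "g = GX j" "1 \<le> j" "j \<le> n"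
      by (auto simp: poly_letter_def)
    then show thesis
    proof cases
      case scalar
      have "gen_rename (adj i) g = g" using scalar by (auto simp: scal_gen_def gen_rename_def)
      moreover have "G g * \<phi> (fgen Gh - (fgen Gp - fgen Gq) * fgen (GX i)) = \<phi> (fgen Gh - (fgen Gp - fgen Gq) * fgen (GX i)) * G g"
        using scalar by (intro central) simp
      then have "G g * ?r = ?r * G g" by (simp add: hom_simps)
      ultimately show thesis using that(3) gen_central scalar by metis
    next
      case var
      show thesis
      proof (cases "j = i \<or> j = Suc i")
        case True
        then show thesis using that(1,2) var by blast
      next
        case False
        have "gen_rename (adj i) g = g" using False var by (simp add: gen_rename_def transpose_def)
        moreover have "T i * G g = G g * T i" using False var assms T_x_far by simp
        moreover have "G g * x i = x i * G g" "G g * x (Suc i) = x (Suc i) * G g"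
          using var assms x_comm by simp_all
        moreover have "G g * ?r = ?r * G g" using rx[of j] var by simp
        ultimately show thesis using that(3) by blast
      qed
    qed
  qed
  then show ?case
  proof cases
    case 1
    \<comment> \<open>Leibniz rule: the divided difference of x_i w is x_(i+1) times that of w, plus
      w.\<close>
    have "x (Suc i) * d + ?w \<in> polys" using assms d wp by (intro polys_intros) auto
    then show ?thesis using twisted_leibniz_step[OF pre] 1 assms
      by (intro bexI[of _ "x (Suc i) * d + ?w"]) (simp_all add: gen_rename_GX)
  next
    case 2
    \<comment> \<open>Likewise for x_(i+1) w, the divided difference of x_(i+1) being -1.\<close>
    have "x i * d - ?w \<in> polys" using assms d wp by (intro polys_intros) auto
    then show ?thesis using twisted_leibniz_step'[OF pre] 2 assms
      by (intro bexI[of _ "x i * d - ?w"]) (simp_all add: gen_rename_GX)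
  next
    case 3
    have "G g * d \<in> polys" using Cons.prems d by (intro polys_mult polys_letter) auto
    moreover have "G g * ?w - G g * ?w' = (x i - x (Suc i)) * (G g * d)"
    proof -
      have "G g * ?w - G g * ?w' = (G g * (x i - x (Suc i))) * d"
        unfolding mult.assoc d(2)[symmetric] by (simp add: right_diff_distrib)
      also have "G g * (x i - x (Suc i)) = (x i - x (Suc i)) * G g"
        using 3(3,4) by (simp add: left_diff_distrib right_diff_distrib)
      finally show ?thesis by (simp add: mult.assoc)
    qed
    moreover have "T i * (G g * ?w) = G g * ?w' * T i + ?r * (G g * d)"
    proof -
      have "T i * (G g * ?w) = G g * (T i * ?w)" using 3(2) by (metis mult.assoc)
      also have "\<dots> = G g * ?w' * T i + G g * ?r * d" unfolding d(3) mult.assoc by (rule distrib_left)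
      finally show ?thesis using 3(5) by (simp add: mult.assoc)
    qed
    moreover have "T i * (G g * ?w') = G g * ?w * T i - ?r * (G g * d)"
    proof -
      have "T i * (G g * ?w') = G g * (T i * ?w')" using 3(2) by (metis mult.assoc)
      also have "\<dots> = G g * ?w * T i - G g * ?r * d" unfolding d(4) mult.assoc by (rule right_diff_distrib)
      finally show ?thesis using 3(5) by (simp add: mult.assoc)
    qed
    ultimately show ?thesis using 3(1) by (intro bexI[of _ "G g * d"]) simp_all
  qed
qed

lemma T_poly:
  assumes "1 \<le> i" "i < n" "a \<in> polys"
  shows "\<exists>b\<in>polys. \<exists>c\<in>polys. T i * a = b * T i + c"
proof -
  obtain S k where S: "\<And>u g. u \<in> S \<Longrightarrow> g \<in> set u \<Longrightarrow> poly_letter n g"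
    "a = (\<Sum>u\<in>S. \<phi> (fconst (k u)) * Wd u)" using polysE[OF assms(3)] by metis
  let ?r = "G Gh - (p - q) * x i" and ?s = "map (gen_rename (adj i))"
  have rp: "?r \<in> polys" using assms by (intro polys_intros) auto
  have "\<exists>d. \<forall>u\<in>S. d u \<in> polys \<and> T i * Wd u = Wd (?s u) * T i + ?r * d u"
  proof (rule bchoice, rule ballI)
    fix u assume "u \<in> S"
    from Wd_rename_eq[OF assms(1,2) S(1)[OF this]]
    show "\<exists>d. d \<in> polys \<and> T i * Wd u = Wd (?s u) * T i + ?r * d" by blast
  qed
  then obtain d where d: "\<And>u. u \<in> S \<Longrightarrow> d u \<in> polys" "\<And>u. u \<in> S \<Longrightarrow> T i * Wd u = Wd (?s u) * T i + ?r * d u"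
    by blast
  have "T i * (\<phi> (fconst (k u)) * Wd u) = \<phi> (fconst (k u)) * Wd (?s u) * T i + \<phi> (fconst (k u)) * (?r * d u)" if "u \<in> S" for u
  proof -
    have "T i * (\<phi> (fconst (k u)) * Wd u) = \<phi> (fconst (k u)) * (T i * Wd u)"
      by (rule const_left_commute)
    then show ?thesis using d(2)[OF that] by (simp add: distrib_left mult.assoc)
  qed
  then have "T i * a = (\<Sum>u\<in>S. \<phi> (fconst (k u)) * Wd (?s u)) * T i + (\<Sum>u\<in>S. \<phi> (fconst (k u)) * (?r * d u))"
    by (simp add: S(2) sum_distrib_left sum_distrib_right sum.distrib)
  moreover have "poly_letter n (gen_rename (adj i) g)" if "poly_letter n g" for g
    using that assms(1,2) adj_in_range[OF assms(1,2)]
    by (auto simp: poly_letter_def scal_gen_def gen_rename_def)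
  then have "(\<Sum>u\<in>S. \<phi> (fconst (k u)) * Wd (?s u)) \<in> polys"
    using S(1) by (intro polys_sum polys_word) auto
  moreover have "(\<Sum>u\<in>S. \<phi> (fconst (k u)) * (?r * d u)) \<in> polys"
    using d(1) by (intro polys_sum polys_mult polys_const rp)
  ultimately show ?thesis by blast
qed

lemma B_poly:
  assumes "1 \<le> i" "i < n" "a \<in> polys"
  shows "\<exists>b\<in>polys. \<exists>c\<in>polys. B i * a = b * B i + c"
proof -
  obtain b c where bc: "b \<in> polys" "c \<in> polys" "T i * a = b * T i + c" using T_poly[OF assms] by blast
  then have "B i * a = b * B i + (c + (p - q) * a - b * (p - q))"
    by (simp add: B_eq distrib_left distrib_right)
  moreover have "c + (p - q) * a - b * (p - q) \<in> polys" using bc assms by (intro polys_intros)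
  ultimately show ?thesis using bc by blast
qed

lemma M_mp_rename:
  assumes "is_Ahx n f" "1 \<le> i" "i < n"
  shows "M (mp_rename (adj i) f) = (\<Sum>m\<in>Poly_Mapping.keys f.
    \<phi> (fconst (Poly_Mapping.lookup f m)) * Wd (map (gen_rename (adj i)) (mono_word m)))"
proof -
  let ?s = "gen_rename (adj i)"
  let ?ren = "\<lambda>m. \<Sum>v\<in>Poly_Mapping.keys m. Poly_Mapping.single (?s v) (Poly_Mapping.lookup m v)"
  have pl: "poly_letter n (?s g)" if "poly_letter n g" for g
    using that assms(2,3) adj_in_range[OF assms(2,3)]
    by (auto simp: poly_letter_def scal_gen_def gen_rename_def)
  have "Wd (mono_word (?ren m)) = Wd (map ?s (mono_word m))" if m: "m \<in> Poly_Mapping.keys f" for m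
  proof (rule Wd_mset_cong[symmetric])
    have "mset (map ?s (mono_word m)) = image_mset ?s (mono_mset m)" by (simp add: mset_mono_word)
    also have "\<dots> = (\<Sum>v\<in>Poly_Mapping.keys m. image_mset ?s (replicate_mset (Poly_Mapping.lookup m v) v))"
      unfolding mono_mset_def by (rule image_mset_sum)
    also have "\<dots> = mset (mono_word (?ren m))" by (simp add: mset_mono_word mono_mset_sum)
    finally show "mset (map ?s (mono_word m)) = mset (mono_word (?ren m))" .
    show "poly_letter n g" if "g \<in> set (map ?s (mono_word m))" for g
      using that m assms(1) pl by (auto simp: is_Ahx_iff set_mono_word)
  qed
  then show ?thesis
    unfolding mp_rename_def by (simp add: mp_to_fa_sum mp_to_fa_single hom_sum single_hom)
qed

text \<open>As \<open>2 f = f + s\<^sub>i f\<close>, it suffices that \<open>T\<^sub>i\<close> commutes with \<open>m + s\<^sub>i m\<close> for monomials \<open>m\<close>, where the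
  two divided differences cancel.\<close>

lemma B_commutes_symmetric:
  assumes "is_Ahx n f" "1 \<le> i" "i < n" "mp_rename (adj i) f = f"
  shows "B i * M f = M f * B i"
proof -
  let ?s = "map (gen_rename (adj i))" and ?k = "\<lambda>m. \<phi> (fconst (Poly_Mapping.lookup f m))"
  have two: "M f + M f = (\<Sum>m\<in>Poly_Mapping.keys f. ?k m * (Wd (mono_word m) + Wd (?s (mono_word m))))"
  proof -
    have "M f + M f = M f + M (mp_rename (adj i) f)" by (simp add: assms(4))
    then show ?thesis
      unfolding M_mp_rename[OF assms(1-3)] M_eq[of f] by (simp add: distrib_left sum.distrib)
  qed
  have "T i * (?k m * (Wd (mono_word m) + Wd (?s (mono_word m))))
    = ?k m * (Wd (mono_word m) + Wd (?s (mono_word m))) * T i" if m: "m \<in> Poly_Mapping.keys f" for m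
  proof -
    have "\<And>g. g \<in> set (mono_word m) \<Longrightarrow> poly_letter n g"
      using m assms(1) by (auto simp: is_Ahx_iff set_mono_word)
    from Wd_rename_eq[of i "mono_word m", OF assms(2,3) this]
    have "T i * (Wd (mono_word m) + Wd (?s (mono_word m))) = (Wd (mono_word m) + Wd (?s (mono_word m))) * T i"
      by (auto simp: distrib_left distrib_right)
    then show ?thesis by (simp only: const_left_commute mult.assoc)
  qed
  then have *: "T i * (M f + M f) = (M f + M f) * T i"
    unfolding two by (simp add: sum_distrib_left sum_distrib_right)
  \<comment> \<open>The doubling is undone by the rational constant 1/2.\<close>
  have half: "\<phi> (fconst (1/2)) * (a + a) = a" for a
  proof -
    have "fconst (1/2) + fconst (1/2) = 1"
      by (simp add: fconst_def flip: single_add zero_list_def)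
    then have "\<phi> (fconst (1/2)) + \<phi> (fconst (1/2)) = 1" by (metis add one)
    then show ?thesis by (simp add: distrib_left flip: distrib_right)
  qed
  have "T i * M f = \<phi> (fconst (1/2)) * (T i * (M f + M f))"
    using half[of "T i * M f"] by (simp add: distrib_left)
  also have "\<dots> = (\<phi> (fconst (1/2)) * (M f + M f)) * T i" by (simp only: * mult.assoc)
  also have "\<dots> = M f * T i" by (simp only: half)
  finally show ?thesis by (simp add: B_eq distrib_left distrib_right c_central)
qed

end

section \<open>Expansions in the barred elements with polynomial coefficients on the left\<close>

context hecke_hom
begin

definition hspan :: "'a set" where
  "hspan = {\<Sum>u\<in>Sn n. c u * W u | c. \<forall>u. c u \<in> polys}"

lemma hspanI: "(\<And>u. c u \<in> polys) \<Longrightarrow> (\<Sum>u\<in>Sn n. c u * W u) \<in> hspan"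
  unfolding hspan_def by blast

lemma hspan_add:
  assumes "y \<in> hspan" "z \<in> hspan"
  shows "y + z \<in> hspan"
proof -
  obtain c d where "\<forall>u. c u \<in> polys" "\<forall>u. d u \<in> polys"
    "y = (\<Sum>u\<in>Sn n. c u * W u)" "z = (\<Sum>u\<in>Sn n. d u * W u)" using assms by (auto simp: hspan_def)
  then show ?thesis using hspanI[of "\<lambda>u. c u + d u"] by (simp add: sum.distrib distrib_right polys_add)
qed

lemma hspan_single:
  assumes "a \<in> polys" "v \<in> Sn n"
  shows "a * W v \<in> hspan"
proof -
  have "a * W v = (\<Sum>u\<in>Sn n. (if u = v then a else 0) * W u)"
    using assms(2) by (simp add: if_distrib[of "\<lambda>z. z * _"] cong: if_cong)
  also have "\<dots> \<in> hspan" by (rule hspanI) (simp add: assms(1) polys_0)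
  finally show ?thesis .
qed

lemma hspan_0: "0 \<in> hspan"
  using hspan_single[OF polys_0 id_in_Sn] by simp

lemma hspan_sum: "(\<And>v. v \<in> S \<Longrightarrow> F v \<in> hspan) \<Longrightarrow> sum F S \<in> hspan"
  by (induction S rule: infinite_finite_induct) (auto intro: hspan_0 hspan_add)

lemma W_central: "(p - q) * W w = W w * (p - q)" "p * q * W w = W w * (p * q)"
proof -
  show "(p - q) * W w = W w * (p - q)" using c_central[of "Tbarw n w"] by (simp add: Tbarw_hom)
  have "p * q * W w = p * (W w * q)" using q_central[of "Tbarw n w"] by (simp add: Tbarw_hom mult.assoc)
  also have "\<dots> = W w * p * q" using p_central[of "Tbarw n w"] by (simp add: Tbarw_hom flip: mult.assoc)
  finally show "p * q * W w = W w * (p * q)" by (simp add: mult.assoc)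
qed

lemma W_p_power: "W w * p ^ j = p ^ j * W w"
  using power_commuting_commutes[OF p_central[of "Tbarw n w"], of j] by (simp add: Tbarw_hom)

text \<open>At an ascent of u the factor lengthens u; at a descent the quadratic relation gives two
  terms, whose central scalars move into the left coefficients.\<close>

lemma hspan_times_B:
  assumes "y \<in> hspan" "1 \<le> i" "i < n"
  shows "y * B i \<in> hspan"
proof -
  obtain c where c: "\<forall>u. c u \<in> polys" "y = (\<Sum>u\<in>Sn n. c u * W u)" using assms by (auto simp: hspan_def)
  have "c u * W u * B i \<in> hspan" if u: "u \<in> Sn n" for u
  proof -
    have ui: "u \<circ> adj i \<in> Sn n" using u assms by (intro comp_in_Sn adj_in_Sn)
    have "u i \<noteq> u (Suc i)" using inj_Sn[OF u] by (simp add: inj_eq)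
    then consider "u i < u (Suc i)" | "u (Suc i) < u i" by linarith
    then show ?thesis
    proof cases
      case 1
      then have "c u * W u * B i = c u * W (u \<circ> adj i)"
        using BF.wprod_ascent[OF u assms(2,3)] by (simp add: mult.assoc)
      then show ?thesis using hspan_single[OF _ ui] c by metis
    next
      case 2
      then have "c u * W u * B i = c u * (p - q) * W u + c u * (p * q) * W (u \<circ> adj i)"
        using W_descent[OF u assms(2,3)]
        by (simp add: mult.assoc distrib_left flip: W_central)
      moreover have "c u * (p - q) \<in> polys" "c u * (p * q) \<in> polys"
        using c by (auto intro!: polys_intros)
      ultimately show ?thesis using hspan_single u ui hspan_add by metis
    qed
  qed
  then show ?thesis unfolding c(2) sum_distrib_right by (intro hspan_sum)
qed

text \<open>All polynomials are treated at once, because moving \<open>B i\<close> past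
  \<open>a\<close> replaces \<open>a\<close> by two other polynomials before the induction
  hypothesis applies.\<close>

lemma W_times_poly:
  assumes "w \<in> Sn n"
  shows "\<forall>a\<in>polys. W w * a \<in> hspan"
  using assms
proof (induction rule: Sn_induct)
  case id
  show "\<forall>a\<in>polys. W id * a \<in> hspan" using hspan_single[OF _ id_in_Sn] by simp
next
  case (ascent v i)
  show "\<forall>a\<in>polys. W (v \<circ> adj i) * a \<in> hspan"
  proof
    fix a assume "a \<in> polys"
    then obtain b c where bc: "b \<in> polys" "c \<in> polys" "B i * a = b * B i + c"
      using B_poly ascent by blast
    have "W (v \<circ> adj i) * a = W v * (B i * a)"
      using BF.wprod_ascent[of v i] ascent by (simp add: mult.assoc)
    also have "\<dots> = W v * b * B i + W v * c" by (simp add: bc(3) distrib_left mult.assoc)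
    finally show "W (v \<circ> adj i) * a \<in> hspan"
      using ascent bc by (metis hspan_add hspan_times_B)
  qed
qed

lemma W_times_poly_expansion:
  assumes "w \<in> Sn n" "a \<in> polys" "k \<le> n"
  shows "\<exists>c. (\<forall>lam v. is_Ahx n (c lam v)) \<and>
    W w * a = (\<Sum>(lam, v)\<in>parts n k \<times> young n k. M (c lam v) * (W (wlam n k lam) * W v))"
proof -
  obtain d where d: "\<forall>u. d u \<in> polys" "W w * a = (\<Sum>u\<in>Sn n. d u * W u)"
    using W_times_poly[OF assms(1)] assms(2) by (auto simp: hspan_def)
  have "\<forall>u. \<exists>f. is_Ahx n f \<and> M f = d u" using d(1) unfolding polys_def by (metis imageE mem_Collect_eq)
  then obtain f where f: "\<And>u. is_Ahx n (f u)" "\<And>u. M (f u) = d u" by metis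
  have "W w * a = (\<Sum>u\<in>Sn n. M (f u) * W u)" using d f by simp
  also have "\<dots> = (\<Sum>z\<in>parts n k \<times> young n k. case z of (lam, v) \<Rightarrow> M (f (wlam n k lam \<circ> v)) * W (wlam n k lam \<circ> v))"
    by (subst sum.reindex_bij_betw[OF wlam_factorization_bij[OF assms(3)], symmetric]) (auto intro: sum.cong)
  also have "\<dots> = (\<Sum>(lam, v)\<in>parts n k \<times> young n k. M (f (wlam n k lam \<circ> v)) * (W (wlam n k lam) * W v))"
    using assms(3) wlam_in_Sn wlam_ascending_lower wlam_ascending_upper
    by (intro sum.cong) (auto simp: BF.wprod_comp_young)
  finally show ?thesis using f(1) by (intro exI[of _ "\<lambda>lam v. f (wlam n k lam \<circ> v)"]) blast
qed

subsection \<open>The parabolic symmetrizer\<close>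

text \<open>The element \<open>Sigma_nk\<close> without its normalizing factor \<open>Gc\<close>,
  hence free of denominators.\<close>

definition symm :: "nat \<Rightarrow> 'a" where
  "symm k = (\<Sum>v\<in>young n k. q ^ (dkn n k - plen n v) * W v)"

lemma Sigma_nk_hom: "\<phi> (Sigma_nk n k) = G Gc * symm k"
  by (simp add: Sigma_nk_def symm_def fmul_eq_times fpow_eq_power hom_simps Tbarw_hom)

text \<open>Pair v with s_i v, the former shorter. The exponent of q drops by one, so up to a power
  of q the pair contributes (q + \<open>B i\<close>) \<open>W v\<close>, and the quadratic relation
  says that \<open>B i\<close> multiplies q + \<open>B i\<close> by p.\<close>

lemma B_symm:
  assumes "1 \<le> i" "i < n" "i \<noteq> k" "k \<le> n"
  shows "B i * symm k = p * symm k"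
proof -
  let ?F = "\<lambda>v. q ^ (dkn n k - plen n v) * W v" and ?A = "{v \<in> young n k. inv v i < inv v (Suc i)}"
  have split: "symm k = (\<Sum>v\<in>?A. ?F v + ?F (adj i \<circ> v))"
    unfolding symm_def
  proof (rule sum_involution)
    fix v assume v: "v \<in> young n k"
    show "adj i \<circ> v \<in> young n k" using v assms by (intro comp_in_young adj_in_young)
    show "adj i \<circ> (adj i \<circ> v) = v" by simp
    have v': "v \<in> Sn n" using v young_subset_Sn by blast
    have "bij v" using v by (auto simp: young_def dest: permutes_bij)
    then have "inv (adj i \<circ> v) = inv v \<circ> adj i" by (simp add: o_inv_distrib)
    moreover have "inv v i \<noteq> inv v (Suc i)" using inj_Sn[OF inv_in_Sn[OF v']] by (simp add: inj_eq)
    ultimately show "inv (adj i \<circ> v) i < inv (adj i \<circ> v) (Suc i) \<longleftrightarrow> \<not> inv v i < inv v (Suc i)" by auto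
  qed simp
  have "B i * (?F v + ?F (adj i \<circ> v)) = p * (?F v + ?F (adj i \<circ> v))" if v: "v \<in> ?A" for v
  proof -
    have v': "v \<in> Sn n" using v young_subset_Sn by blast
    define e where "e = q ^ (dkn n k - plen n (adj i \<circ> v))"
    have len: "plen n (adj i \<circ> v) = Suc (plen n v)" using v v' assms by (intro plen_left_ascent) auto
    moreover have "plen n (adj i \<circ> v) \<le> dkn n k"
      using v assms by (intro plen_young_le_dkn comp_in_young adj_in_young) auto
    \<comment> \<open>The length bound ensures that the exponent really drops by one under truncated
      subtraction.\<close>
    ultimately have "dkn n k - plen n v = Suc (dkn n k - plen n (adj i \<circ> v))" by simp
    then have e: "q ^ (dkn n k - plen n v) = q * e" by (simp add: e_def)
    have Ws: "W (adj i \<circ> v) = B i * W v" using v v' assms by (intro BF.wprod_left_ascent) auto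
    have ec: "e * \<phi> a = \<phi> a * e" for a
      unfolding e_def by (rule power_commuting_commutes) (rule q_central)
    have l1: "B i * (q * z) = q * (B i * z)" "B i * (e * z) = e * (B i * z)"
      "e * (p * z) = p * (e * z)" "e * (q * z) = q * (e * z)" "q * (p * z) = p * (q * z)" for z
      by (simp_all add: q_central ec flip: mult.assoc)
    have BB: "B i * (B i * z) = (p - q) * (B i * z) + p * (q * z)" for z
      by (simp add: B_quad[OF assms(1,2)] distrib_right mult.assoc flip: mult.assoc[of "B i" "B i"])
    have "B i * (q * e * W v + e * (B i * W v)) = p * (q * e * W v + e * (B i * W v))"
      by (simp add: distrib_left left_diff_distrib right_diff_distrib mult.assoc l1 BB)
    then show ?thesis unfolding e Ws e_def[symmetric] .
  qed
  then show ?thesis unfolding split by (simp add: sum_distrib_left)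
qed

lemma W_symm:
  assumes "v \<in> young n k" "k \<le> n"
  shows "W v * symm k = p ^ plen n v * symm k"
  using assms
proof (induction rule: young_induct)
  case id
  show "W id * symm k = p ^ plen n id * symm k" by simp
next
  case (ascent v i)
  have v: "v \<in> Sn n" using ascent young_subset_Sn by blast
  have "W (v \<circ> adj i) * symm k = W v * (B i * symm k)"
    using BF.wprod_ascent[OF v] ascent by (simp add: mult.assoc)
  also have "\<dots> = W v * p * symm k" using B_symm[of i k] ascent assms by (simp add: mult.assoc)
  also have "\<dots> = p * (W v * symm k)" using W_p_power[of v 1] by (simp add: mult.assoc)
  also have "\<dots> = p ^ plen n (v \<circ> adj i) * symm k"
    using ascent plen_comp_adj_ascent[of i n v] by (simp add: mult.assoc)
  finally show "W (v \<circ> adj i) * symm k = p ^ plen n (v \<circ> adj i) * symm k" .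
qed

lemma W_commutes_symmetric:
  assumes "v \<in> young n k" "k \<le> n" "is_Ahx n f" "block_symmetric n k f"
  shows "W v * M f = M f * W v"
  using assms(1,2)
proof (induction rule: young_induct)
  case id
  show "W id * M f = M f * W id" by simp
next
  case (ascent v i)
  have v: "v \<in> Sn n" using ascent young_subset_Sn by blast
  have "mp_rename (adj i) f = f" using assms(4) ascent adj_in_young by (auto simp: block_symmetric_def)
  then have "B i * M f = M f * B i" using B_commutes_symmetric assms(3) ascent by blast
  moreover have "W (v \<circ> adj i) = W v * B i" using BF.wprod_ascent[OF v] ascent by simp
  ultimately show "W (v \<circ> adj i) * M f = M f * W (v \<circ> adj i)"
    using ascent.IH by (simp add: mult.assoc) (simp flip: mult.assoc)
qed

lemma symm_commutes_symmetric:
  assumes "k \<le> n" "is_Ahx n f" "block_symmetric n k f"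
  shows "symm k * M f = M f * symm k"
proof -
  have "q ^ j * W v * M f = M f * (q ^ j * W v)" if "v \<in> young n k" for v j
  proof -
    have "q ^ j * M f = M f * q ^ j" by (rule power_commuting_commutes) (rule q_central)
    then show ?thesis using W_commutes_symmetric[OF that assms] by (simp add: mult.assoc) (simp flip: mult.assoc)
  qed
  then show ?thesis by (simp add: symm_def sum_distrib_left sum_distrib_right)
qed

text \<open>The symmetrizer passes \<open>f\<close>, and each \<open>W v\<close> arriving next to it
  turns into a power of p. The central \<open>Gc\<close> is parked at the right end, so that the
  assumed expansion applies to an expression without denominators.\<close>

lemma Tbar_lam_times_symmetric:
  assumes "k \<le> n" "is_Ahx n f" "block_symmetric n k f"
    and c: "W (wlam n k mu) * M f = (\<Sum>(lam, v)\<in>parts n k \<times> young n k. c lam v * (W (wlam n k lam) * W v))"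
  shows "\<phi> (Tbar_lam n k mu) * M f
    = (\<Sum>lam\<in>parts n k. (\<Sum>v\<in>young n k. c lam v * p ^ plen n v) * \<phi> (Tbar_lam n k lam))"
proof -
  have Tb: "\<phi> (Tbar_lam n k lam) = W (wlam n k lam) * symm k * G Gc" for lam
  proof -
    have "symm k = \<phi> (\<Sum>v\<in>young n k. fgen Gq ^ (dkn n k - plen n v) * Tbarw n v)"
      by (simp add: symm_def hom_simps Tbarw_hom)
    then have "G Gc * symm k = symm k * G Gc" using central[of Gc] by simp
    then show ?thesis by (simp add: Tbar_lam_def fmul_eq_times mult Sigma_nk_hom Tbarw_hom mult.assoc)
  qed
  have "\<phi> (Tbar_lam n k mu) * M f = W (wlam n k mu) * (symm k * M f) * G Gc"
    by (simp add: Tb mult.assoc central[of Gc])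
  also have "\<dots> = W (wlam n k mu) * M f * symm k * G Gc"
    by (simp add: symm_commutes_symmetric[OF assms(1-3)] mult.assoc)
  also have "\<dots> = (\<Sum>(lam, v)\<in>parts n k \<times> young n k. c lam v * (W (wlam n k lam) * (W v * symm k)) * G Gc)"
    by (simp add: c sum_distrib_right mult.assoc case_prod_unfold)
  also have "\<dots> = (\<Sum>(lam, v)\<in>parts n k \<times> young n k. c lam v * p ^ plen n v * \<phi> (Tbar_lam n k lam))"
  proof (rule sum.cong[OF refl], clarify)
    fix lam v assume "v \<in> young n k"
    then have "W (wlam n k lam) * (W v * symm k) = W (wlam n k lam) * p ^ plen n v * symm k"
      using W_symm assms(1) by (simp add: mult.assoc)
    also have "W (wlam n k lam) * p ^ plen n v = p ^ plen n v * W (wlam n k lam)"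
      by (rule W_p_power)
    finally show "c lam v * (W (wlam n k lam) * (W v * symm k)) * G Gc = c lam v * p ^ plen n v * \<phi> (Tbar_lam n k lam)"
      by (simp add: Tb mult.assoc)
  qed
  finally show ?thesis by (simp add: sum.cartesian_product sum_distrib_right)
qed

end

subsection \<open>Schubert representations\<close>

lemma w0_permutes: "w0 n permutes {1..n}"
proof (rule bij_imp_permutes)
  show "bij_betw (w0 n) {1..n} {1..n}"
    by (rule bij_betw_byWitness[where f' = "w0 n"]) (auto simp: w0_def)
qed (auto simp: w0_def)

lemma w0_w0: "w0 n (w0 n a) = a"
  by (auto simp: w0_def)

locale schubert =
  fixes n :: nat and scale :: "'f::field_char_0 \<Rightarrow> 'v::ab_group_add \<Rightarrow> 'v" and pF qF hF :: 'f
    and t :: "nat \<Rightarrow> 'f" and Top Xop :: "nat \<Rightarrow> 'v \<Rightarrow> 'v" and Y :: "(nat \<Rightarrow> nat) \<Rightarrow> 'v" and ev :: "'v \<Rightarrow> 'f"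
  assumes rep: "schubert_rep n scale pF qF hF t Top Xop Y ev"
begin

sublocale vector_space scale
  using rep by (simp add: schubert_rep_def)

sublocale hecke_hom n "hecke_class n"
  by (rule hecke_hom_hecke_class)

abbreviation gact :: "gen \<Rightarrow> 'v \<Rightarrow> 'v" where "gact \<equiv> gen_act n scale pF qF hF Top Xop"
abbreviation act :: "fa \<Rightarrow> 'v \<Rightarrow> 'v" where "act \<equiv> vact n scale pF qF hF Top Xop"

definition wact :: "gen list \<Rightarrow> 'v \<Rightarrow> 'v" where
  "wact u = foldr (\<lambda>g h. gact g \<circ> h) u id"

lemma wact_Nil [simp]: "wact [] y = y"
  by (simp add: wact_def)

lemma wact_Cons [simp]: "wact (g # u) y = gact g (wact u y)"
  by (simp add: wact_def)

lemma wact_append: "wact (u @ w) y = wact u (wact w y)"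
  by (induction u) simp_all

lemma Top_linear:
  assumes "1 \<le> i" "i < n"
  shows "Top i (y + z) = Top i y + Top i z" "Top i (scale c y) = scale c (Top i y)"
proof -
  have "Vector_Spaces.linear scale scale (Top i)" using rep assms by (simp add: schubert_rep_def)
  then show "Top i (y + z) = Top i y + Top i z" "Top i (scale c y) = scale c (Top i y)"
    by (simp_all add: Vector_Spaces.linear_iff)
qed

lemma Xop_linear:
  assumes "1 \<le> i" "i \<le> n"
  shows "Xop i (y + z) = Xop i y + Xop i z" "Xop i (scale c y) = scale c (Xop i y)"
proof -
  have "Vector_Spaces.linear scale scale (Xop i)" using rep assms by (simp add: schubert_rep_def)
  then show "Xop i (y + z) = Xop i y + Xop i z" "Xop i (scale c y) = scale c (Xop i y)"
    by (simp_all add: Vector_Spaces.linear_iff)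
qed

lemma gact_add: "gact g (y + z) = gact g y + gact g z"
  by (cases g) (auto simp: gen_act_def Top_linear Xop_linear scale_right_distrib)

lemma gact_scale: "gact g (scale c y) = scale c (gact g y)"
  by (cases g) (auto simp: gen_act_def Top_linear Xop_linear mult.commute)

lemma wact_add: "wact u (y + z) = wact u y + wact u z"
  by (induction u) (simp_all add: gact_add)

lemma wact_scale: "wact u (scale c y) = scale c (wact u y)"
  by (induction u) (simp_all add: gact_scale)

lemma wact_sum: "wact u (sum F S) = (\<Sum>v\<in>S. wact u (F v))"
  using wact_scale[of u 0 0] by (induction S rule: infinite_finite_induct) (simp_all add: wact_add)

lemma act_eq: "act a y = (\<Sum>u\<in>Poly_Mapping.keys a. scale (of_rat (Poly_Mapping.lookup a u)) (wact u y))"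
  by (simp add: vact_def wact_def)

lemma act_0 [simp]: "act 0 y = 0"
  by (simp add: act_eq)

lemma act_plus: "act (a + b) y = act a y + act b y"
  unfolding act_eq by (rule setsum_keys_plus_distrib) (simp_all add: of_rat_add scale_left_distrib)

lemma act_uminus: "act (- a) y = - act a y"
  using act_plus[of a "- a" y] by (simp add: eq_neg_iff_add_eq_0 add.commute)

lemma act_minus: "act (a - b) y = act a y - act b y"
  using act_plus[of a "- b" y] by (simp add: act_uminus)

lemma act_sum: "act (sum F S) y = (\<Sum>v\<in>S. act (F v) y)"
  by (induction S rule: infinite_finite_induct) (simp_all add: act_plus)

lemma act_single: "act (Poly_Mapping.single u c) y = scale (of_rat c) (wact u y)"
  by (cases "c = 0") (simp_all add: act_eq)

lemma act_fgen: "act (fgen g) y = gact g y"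
  by (simp add: fgen_def act_single)

lemma act_one: "act 1 y = y"
  by (simp add: act_single fone_def fconst_def flip: fone_eq_one)

lemma act_add: "act a (y + z) = act a y + act a z"
  by (simp add: act_eq wact_add scale_right_distrib sum.distrib)

lemma act_scale: "act a (scale c y) = scale c (act a y)"
  by (simp add: act_eq wact_scale scale_sum_right mult.commute)

lemma act_zero [simp]: "act a 0 = 0"
  using act_scale[of a 0 0] by simp

lemma act_sum_right: "act a (sum F S) = (\<Sum>v\<in>S. act a (F v))"
  by (induction S rule: infinite_finite_induct) (simp_all add: act_add)

lemma act_times: "act (a * b) y = act a (act b y)"
proof -
  have "act (a * b) y = (\<Sum>u\<in>Poly_Mapping.keys a. \<Sum>w\<in>Poly_Mapping.keys b.
      scale (of_rat (Poly_Mapping.lookup a u)) (wact u (scale (of_rat (Poly_Mapping.lookup b w)) (wact w y))))"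
    by (simp add: fmul_def act_sum act_single wact_append wact_scale of_rat_mult flip: fmul_eq_times)
  also have "\<dots> = act a (act b y)"
    by (simp add: act_eq wact_sum scale_sum_right)
  finally show ?thesis .
qed

lemma act_rels:
  assumes "r \<in> rels n"
  shows "act r y = 0"
proof (cases "r \<in> hrel n")
  case True
  then show ?thesis using rep unfolding schubert_rep_def by blast
next
  case False
  then obtain g where "r = fcomm (fgen Gc) (fgen g)" using assms by (auto simp: rels_def)
  moreover have "gact g 0 = 0" using gact_scale[of g 0 0] by simp
  ultimately show ?thesis by (simp add: fcomm_eq act_minus act_times act_fgen gen_act_def[of _ _ _ _ _ _ _ Gc])
qed

lemma act_fideal: "a \<in> fideal (rels n) \<Longrightarrow> act a y = 0"
  by (induction arbitrary: y rule: fideal.induct) (simp_all add: fmul_eq_times act_times act_rels act_plus)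

text \<open>The passage from ring identities to operators on V: the action is additive and
  multiplicative and kills \<open>rels n\<close>, hence the whole ideal.\<close>

lemma act_cong: "hecke_class n a = hecke_class n b \<Longrightarrow> act a y = act b y"
  using act_fideal[of "a - b" y] by (simp add: hecke_class_eq_iff heq_def act_minus)

lemma act_p: "act (fgen Gp) y = scale pF y" and act_q: "act (fgen Gq) y = scale qF y"
  by (simp_all add: act_fgen gen_act_def)

lemma act_p_power: "act (fgen Gp ^ j) y = scale (pF ^ j) y"
  by (induction j) (simp_all add: act_one act_times act_p mult.commute)

lemma ev_add: "ev (y + z) = ev y + ev z" and ev_scale: "ev (scale c y) = c * ev y"
  using rep by (simp_all add: schubert_rep_def Vector_Spaces.linear_iff)

lemma ev_zero [simp]: "ev 0 = 0"
  using ev_scale[of 0 0] by simp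

lemma ev_sum: "ev (sum F S) = (\<Sum>v\<in>S. ev (F v))"
  by (induction S rule: infinite_finite_induct) (simp_all add: ev_add)

lemma ev_Y_neq: "w \<in> Sn n \<Longrightarrow> w \<noteq> id \<Longrightarrow> ev (Y w) = 0" and ev_Y_id: "ev (Y id) \<noteq> 0"
  using rep id_in_Sn[of n] unfolding schubert_rep_def by blast+

lemma span_Y: "span (Y ` Sn n) = UNIV"
  and inj_Y: "inj_on Y (Sn n)"
  and Y_eq: "w \<in> Sn n \<Longrightarrow> Y w = act (Tw n (inv w \<circ> w0 n)) (Y (w0 n))"
  and ev_Xop_Y: "w \<in> Sn n \<Longrightarrow> 1 \<le> i \<Longrightarrow> i \<le> n \<Longrightarrow> ev (Xop i (Y w)) = t i * ev (Y w)"
  using rep unfolding schubert_rep_def by blast+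

lemma ev_Xop:
  assumes "1 \<le> i" "i \<le> n"
  shows "ev (Xop i y) = t i * ev y"
proof -
  have "y \<in> span (Y ` Sn n)" by (simp add: span_Y)
  then show ?thesis
  proof (induction rule: span_induct_alt)
    case base
    show ?case using Xop_linear(2)[OF assms, of 0 0] by simp
  next
    case (step c z y)
    then obtain w where "w \<in> Sn n" "z = Y w" by blast
    then have "ev (Xop i z) = t i * ev z" using ev_Xop_Y assms by blast
    then show ?case using step by (simp add: Xop_linear[OF assms] ev_add ev_scale algebra_simps)
  qed
qed

section \<open>Evaluation of polynomials and duality with the barred elements\<close>

abbreviation val :: "gen \<Rightarrow> 'f" where "val \<equiv> eval_val pF qF hF t"

lemma ev_wact:
  assumes "\<And>g. g \<in> set u \<Longrightarrow> poly_letter n g"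
  shows "ev (wact u y) = prod_list (map val u) * ev y"
  using assms
proof (induction u)
  case (Cons g u)
  have "poly_letter n g" using Cons by simp
  then have "ev (gact g z) = val g * ev z" for z
    by (auto simp: poly_letter_def scal_gen_def gen_act_def eval_val_def ev_scale ev_Xop)
  then show ?case using Cons by simp
qed simp

lemma prod_list_mono_word: "prod_list (map val (mono_word m)) = (\<Prod>v\<in>Poly_Mapping.keys m. val v ^ Poly_Mapping.lookup m v)"
proof -
  have "prod_list (map val (mono_word m)) = prod_mset (image_mset val (mono_mset m))"
    by (metis mset_map mset_mono_word prod_mset_prod_list)
  also have "\<dots> = (\<Prod>v\<in>Poly_Mapping.keys m. prod_mset (image_mset val (replicate_mset (Poly_Mapping.lookup m v) v)))"
  proof -
    have "prod_mset (sum F S) = (\<Prod>v\<in>S. prod_mset (F v))" for F :: "gen \<Rightarrow> 'f multiset" and S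
      by (induction S rule: infinite_finite_induct) simp_all
    then show ?thesis by (simp add: mono_mset_def image_mset_sum)
  qed
  finally show ?thesis by simp
qed

text \<open>Under \<open>ev\<close> each x_i acts as t_i on all of V, so a polynomial standing
  leftmost is evaluated at the parameters. This is the source of the t_i in the final
  formula.\<close>

lemma ev_act_poly:
  assumes "is_Ahx n f"
  shows "ev (act (mp_to_fa f) y) = mp_eval val f * ev y"
proof -
  have "ev (wact (mono_word m) y) = (\<Prod>v\<in>Poly_Mapping.keys m. val v ^ Poly_Mapping.lookup m v) * ev y"
    if "m \<in> Poly_Mapping.keys f" for m
    using assms that by (subst ev_wact) (auto simp: is_Ahx_iff set_mono_word prod_list_mono_word)
  then show ?thesis
    by (simp add: mp_to_fa_def act_sum act_single ev_sum ev_scale mp_eval_def sum_distrib_right mult.assoc)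
qed

text \<open>With u = w^{-1} w0, the class Y_w is T_u applied to Y_{w0}. As u^{-1} = w0 w and w0
  reverses order, a descent of w at i is an ascent of u^{-1}; hence T_i T_u is T of s_i u, the
  permutation that belongs to w s_i.\<close>

lemma act_T_descent:
  assumes "w \<in> Sn n" "1 \<le> i" "i < n" "w (Suc i) < w i"
  shows "act (fgen (GT i)) (Y w) = Y (w \<circ> adj i)"
proof -
  have w0: "w0 n \<in> Sn n" using w0_permutes by (simp add: Sn_def)
  let ?u = "inv w \<circ> w0 n"
  have u: "?u \<in> Sn n" using assms w0 by (intro comp_in_Sn inv_in_Sn)
  have bij: "bij w" "bij (w0 n)" using assms(1) w0 by (auto simp: Sn_def dest: permutes_bij)
  have "inv (w0 n) = w0 n" by (rule inv_equality) (simp_all add: w0_w0)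
  then have inv_u: "inv ?u = w0 n \<circ> w" using bij by (simp add: o_inv_distrib bij_imp_bij_inv inv_inv_eq)
  have "w i \<in> {1..n}" "w (Suc i) \<in> {1..n}"
    using assms permutes_in_image[of w "{1..n}" i] permutes_in_image[of w "{1..n}" "Suc i"]
    by (simp_all add: Sn_def)
  then have "inv ?u i < inv ?u (Suc i)" unfolding inv_u using assms(4) by (simp add: w0_def)
  then have "hecke_class n (Tw n (adj i \<circ> ?u)) = hecke_class n (fgen (GT i) * Tw n ?u)"
    using TF.wprod_left_ascent[OF u assms(2,3)] by (simp add: Tw_hom mult)
  from act_cong[OF this] have "act (Tw n (adj i \<circ> ?u)) (Y (w0 n)) = act (fgen (GT i)) (Y w)"
    using Y_eq[OF assms(1)] by (simp add: act_times)
  moreover have "inv (w \<circ> adj i) \<circ> w0 n = adj i \<circ> ?u" using bij by (simp add: o_inv_distrib comp_assoc)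
  ultimately show ?thesis using Y_eq[OF comp_in_Sn[OF assms(1) adj_in_Sn[OF assms(2,3)]]] by simp
qed

lemma act_Tbar_descent:
  assumes "w \<in> Sn n" "1 \<le> i" "i < n" "w (Suc i) < w i"
  shows "act (Tbar_i i) (Y w) = Y (w \<circ> adj i) + scale (pF - qF) (Y w)"
  using act_T_descent[OF assms]
  by (simp add: Tbar_i_def act_minus act_plus act_p act_q scale_left_diff_distrib)

text \<open>Here w s_i has a descent at i, so Y_w is T_i applied to the class of w s_i, and the
  barred T_i times T_i is pq.\<close>

lemma act_Tbar_ascent:
  assumes "w \<in> Sn n" "1 \<le> i" "i < n" "w i < w (Suc i)"
  shows "act (Tbar_i i) (Y w) = scale (pF * qF) (Y (w \<circ> adj i))"
proof -
  have "act (fgen (GT i)) (Y (w \<circ> adj i)) = Y (w \<circ> adj i \<circ> adj i)"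
    using assms by (intro act_T_descent comp_in_Sn adj_in_Sn) auto
  then have "act (Tbar_i i) (Y w) = act (Tbar_i i * fgen (GT i)) (Y (w \<circ> adj i))"
    by (simp add: act_times)
  also have "\<dots> = act (fgen Gp * fgen Gq) (Y (w \<circ> adj i))"
    by (rule act_cong) (simp add: mult B_T[OF assms(2,3)])
  finally show ?thesis by (simp add: act_times act_p act_q)
qed

lemma act_Tbarw_ascent:
  assumes "w \<in> Sn n" "1 \<le> i" "i < n" "w i < w (Suc i)"
  shows "act (Tbarw n (w \<circ> adj i)) y = act (Tbarw n w) (act (Tbar_i i) y)"
proof -
  have "hecke_class n (Tbarw n (w \<circ> adj i)) = hecke_class n (Tbarw n w * Tbar_i i)"
    using BF.wprod_ascent[OF assms] by (simp add: Tbarw_hom mult)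
  from act_cong[OF this] show ?thesis by (simp add: act_times)
qed

lemma act_Tbarw_id: "act (Tbarw n id) y = y"
proof -
  have "hecke_class n (Tbarw n id) = hecke_class n 1" by (simp add: Tbarw_hom one)
  from act_cong[OF this] show ?thesis by (simp add: act_one)
qed

text \<open>The last letter of v s_i is peeled onto Y_u. If u ascends at i, only the class of u s_i
  occurs, and u s_i = v would make u = v s_i, which descends at i. If u descends, the additional
  term in Y_u is invisible to v, because v ascends at i and so differs from u.\<close>

lemma ev_Tbarw_Y:
  assumes "w \<in> Sn n" "u \<in> Sn n"
  shows "ev (act (Tbarw n w) (Y u)) = (if u = w then ev (Y id) else 0)"
proof -
  have "\<forall>u\<in>Sn n. ev (act (Tbarw n w) (Y u)) = (if u = w then ev (Y id) else 0)"
    using assms(1)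
  proof (induction rule: Sn_induct)
    case id
    show "\<forall>u\<in>Sn n. ev (act (Tbarw n id) (Y u)) = (if u = id then ev (Y id) else 0)"
      using ev_Y_neq by (auto simp: act_Tbarw_id)
  next
    case (ascent v i)
    show "\<forall>u\<in>Sn n. ev (act (Tbarw n (v \<circ> adj i)) (Y u)) = (if u = v \<circ> adj i then ev (Y id) else 0)"
    proof
      fix u assume u: "u \<in> Sn n"
      have ui: "u \<circ> adj i \<in> Sn n" using u ascent by (intro comp_in_Sn adj_in_Sn) auto
      have IH: "ev (act (Tbarw n v) (Y u')) = (if u' = v then ev (Y id) else 0)" if "u' \<in> Sn n" for u'
        using ascent.IH that by blast
      have iff: "u \<circ> adj i = v \<longleftrightarrow> u = v \<circ> adj i" by (metis comp_adj_adj)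
      have a: "act (Tbarw n (v \<circ> adj i)) (Y u) = act (Tbarw n v) (act (Tbar_i i) (Y u))"
        using ascent by (intro act_Tbarw_ascent) auto
      have "u i \<noteq> u (Suc i)" using inj_Sn[OF u] by (simp add: inj_eq)
      then consider "u i < u (Suc i)" | "u (Suc i) < u i" by linarith
      then show "ev (act (Tbarw n (v \<circ> adj i)) (Y u)) = (if u = v \<circ> adj i then ev (Y id) else 0)"
      proof cases
        case 1
        then have "u \<noteq> v \<circ> adj i" using ascent by auto
        then show ?thesis
          using act_Tbar_ascent[OF u _ _ 1] ascent IH[OF ui] iff by (simp add: a act_scale ev_scale)
      next
        case 2
        then have "u \<noteq> v" using ascent by auto
        then show ?thesis
          using act_Tbar_descent[OF u _ _ 2] ascent IH[OF ui] IH[OF u] iff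
          by (simp add: a act_scale act_add ev_add ev_scale)
      qed
    qed
  qed
  then show ?thesis using assms(2) by blast
qed

lemma eq_if_ev_Tbarw_eq:
  assumes "\<And>w. w \<in> Sn n \<Longrightarrow> ev (act (Tbarw n w) y) = ev (act (Tbarw n w) z)"
  shows "y = z"
proof -
  have "y - z \<in> span (Y ` Sn n)" by (simp add: span_Y)
  then obtain c where "y - z = (\<Sum>b\<in>Y ` Sn n. scale (c b) b)" by (auto simp: span_finite)
  also have "\<dots> = (\<Sum>u\<in>Sn n. scale (c (Y u)) (Y u))"
    using inj_Y by (simp add: sum.reindex)
  finally have d: "y - z = (\<Sum>u\<in>Sn n. scale (c (Y u)) (Y u))" .
  have "c (Y w) = 0" if w: "w \<in> Sn n" for w
  proof -
    have "ev (act (Tbarw n w) (y - z)) = (\<Sum>u\<in>Sn n. c (Y u) * (if u = w then ev (Y id) else 0))"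
      using w by (simp add: d act_sum_right act_scale ev_sum ev_scale ev_Tbarw_Y)
    also have "\<dots> = c (Y w) * ev (Y id)" using w by (simp add: if_distrib cong: if_cong)
    finally have "ev (act (Tbarw n w) (y - z)) = c (Y w) * ev (Y id)" .
    moreover have "ev (act (Tbarw n w) y) = ev (act (Tbarw n w) (y - z)) + ev (act (Tbarw n w) z)"
      by (simp flip: ev_add act_add)
    ultimately show ?thesis using assms[OF w] ev_Y_id by simp
  qed
  then show ?thesis using d by simp
qed

section \<open>Grassmannian Schubert classes\<close>

abbreviation Yl :: "nat \<Rightarrow> nat list \<Rightarrow> 'v" where "Yl k \<equiv> Y_lam n k scale pF Y"

text \<open>Pair v with v s_i, the former shorter, and put a = w_lam v. The barred T_i sends Y_a + p
  Y_{a s_i} to pq Y_{a s_i} + p Y_a + p(p - q) Y_{a s_i}, which is p times the original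
  vector.\<close>

lemma act_Tbar_Y_lam:
  assumes "lam \<in> parts n k" "k \<le> n" "1 \<le> i" "i < n" "i \<noteq> k"
  shows "act (Tbar_i i) (Yl k lam) = scale pF (Yl k lam)"
proof -
  let ?w = "wlam n k lam"
  let ?F = "\<lambda>v. scale (pF ^ plen n v) (Y (?w \<circ> v))"
  let ?A = "{v \<in> young n k. v i < v (Suc i)}"
  have split: "Yl k lam = (\<Sum>v\<in>?A. ?F v + ?F (v \<circ> adj i))"
    unfolding Y_lam_def
  proof (rule sum_involution)
    fix v assume v: "v \<in> young n k"
    show "v \<circ> adj i \<in> young n k" using v assms by (intro comp_in_young adj_in_young)
    show "v \<circ> adj i \<circ> adj i = v" by simp
    have "v i \<noteq> v (Suc i)" using inj_Sn v young_subset_Sn by (metis inj_eq n_not_Suc_n subsetD)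
    then show "(v \<circ> adj i) i < (v \<circ> adj i) (Suc i) \<longleftrightarrow> \<not> v i < v (Suc i)" by auto
  qed simp
  have "act (Tbar_i i) (?F v + ?F (v \<circ> adj i)) = scale pF (?F v + ?F (v \<circ> adj i))" if v: "v \<in> ?A" for v
  proof -
    have v': "v \<in> Sn n" using v young_subset_Sn by blast
    have wv: "?w \<circ> v \<in> Sn n" using v' by (intro comp_in_Sn wlam_in_Sn assms)
    have wvi: "?w \<circ> v \<circ> adj i \<in> Sn n" using wv assms by (intro comp_in_Sn[OF wv] adj_in_Sn)
    have lt: "?w (v i) < ?w (v (Suc i))"
      using v assms(2-5) wlam_ascending_lower[OF assms(1,2)] wlam_ascending_upper[OF assms(1,2)]
      by (intro blockwise_ascending_comp_young[of v n k i ?w]) simp_all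
    have 1: "act (Tbar_i i) (Y (?w \<circ> v)) = scale (pF * qF) (Y (?w \<circ> v \<circ> adj i))"
      using assms lt by (intro act_Tbar_ascent wv) auto
    have "act (Tbar_i i) (Y (?w \<circ> v \<circ> adj i)) = Y (?w \<circ> v \<circ> adj i \<circ> adj i) + scale (pF - qF) (Y (?w \<circ> v \<circ> adj i))"
      using assms lt by (intro act_Tbar_descent wvi) auto
    then have 2: "act (Tbar_i i) (Y (?w \<circ> v \<circ> adj i)) = Y (?w \<circ> v) + scale (pF - qF) (Y (?w \<circ> v \<circ> adj i))"
      by simp
    have len: "plen n (v \<circ> adj i) = Suc (plen n v)" using v assms by (intro plen_comp_adj_ascent) auto
    have "act (Tbar_i i) (?F v + ?F (v \<circ> adj i)) =
      scale (pF ^ plen n v * (pF * qF)) (Y (?w \<circ> v \<circ> adj i)) + scale (pF ^ Suc (plen n v)) (Y (?w \<circ> v))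
       + scale (pF ^ Suc (plen n v) * (pF - qF)) (Y (?w \<circ> v \<circ> adj i))"
      unfolding act_add act_scale len comp_assoc[symmetric] 1 2
      by (simp only: scale_right_distrib scale_scale add.assoc)
    also have "\<dots> = scale (pF ^ Suc (plen n v)) (Y (?w \<circ> v))
       + scale (pF ^ plen n v * (pF * qF) + pF ^ Suc (plen n v) * (pF - qF)) (Y (?w \<circ> v \<circ> adj i))"
      by (simp only: scale_left_distrib add.assoc add.commute add.left_commute)
    also have "pF ^ plen n v * (pF * qF) + pF ^ Suc (plen n v) * (pF - qF) = pF * pF ^ Suc (plen n v)"
      by (simp add: algebra_simps)
    finally show ?thesis
      unfolding len comp_assoc[symmetric] by (simp only: scale_right_distrib scale_scale power_Suc)
  qed
  then show ?thesis unfolding split act_sum_right scale_sum_right by (rule sum.cong[OF refl])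
qed

lemma act_Tbarw_Y_lam:
  assumes "lam \<in> parts n k" "v \<in> young n k" "k \<le> n"
  shows "act (Tbarw n v) (Yl k lam) = scale (pF ^ plen n v) (Yl k lam)"
  using assms(2,3)
proof (induction rule: young_induct)
  case id
  show "act (Tbarw n id) (Yl k lam) = scale (pF ^ plen n id) (Yl k lam)" by (simp add: act_Tbarw_id)
next
  case (ascent v i)
  have v: "v \<in> Sn n" using ascent young_subset_Sn by blast
  have IH: "act (Tbarw n v) (Yl k lam) = scale (pF ^ plen n v) (Yl k lam)" by (rule ascent.IH)
  have "act (Tbarw n (v \<circ> adj i)) (Yl k lam) = act (Tbarw n v) (act (Tbar_i i) (Yl k lam))"
    using ascent by (intro act_Tbarw_ascent v)
  also have "\<dots> = scale (pF ^ Suc (plen n v)) (Yl k lam)"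
    using act_Tbar_Y_lam[OF assms(1,3), of i] ascent IH by (simp add: act_scale)
  also have "Suc (plen n v) = plen n (v \<circ> adj i)" using plen_comp_adj_ascent[of i n v] ascent by simp
  finally show "act (Tbarw n (v \<circ> adj i)) (Yl k lam) = scale (pF ^ plen n (v \<circ> adj i)) (Yl k lam)" .
qed

text \<open>By uniqueness of the factorization only the summand v = id can meet w_mu, and its weight
  is 1.\<close>

lemma ev_Tbarw_Y_lam:
  assumes "lam \<in> parts n k" "mu \<in> parts n k" "k \<le> n"
  shows "ev (act (Tbarw n (wlam n k mu)) (Yl k lam)) = (if lam = mu then ev (Y id) else 0)"
proof -
  have iff: "wlam n k lam \<circ> v = wlam n k mu \<longleftrightarrow> lam = mu \<and> v = id" if v: "v \<in> young n k" for v
    using inj_onD[OF bij_betw_imp_inj_on[OF wlam_factorization_bij[OF assms(3)]], of "(lam, v)" "(mu, id)"] v assms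
    by auto
  have "ev (act (Tbarw n (wlam n k mu)) (Yl k lam)) =
      (\<Sum>v\<in>young n k. pF ^ plen n v * ev (act (Tbarw n (wlam n k mu)) (Y (wlam n k lam \<circ> v))))"
    by (simp add: Y_lam_def act_sum_right act_scale ev_sum ev_scale)
  also have "\<dots> = (\<Sum>v\<in>young n k. if v = id then (if lam = mu then ev (Y id) else 0) else 0)"
  proof (rule sum.cong[OF refl])
    fix v assume v: "v \<in> young n k"
    have "wlam n k lam \<circ> v \<in> Sn n" using v young_subset_Sn by (intro comp_in_Sn wlam_in_Sn assms) blast
    then show "pF ^ plen n v * ev (act (Tbarw n (wlam n k mu)) (Y (wlam n k lam \<circ> v))) =
      (if v = id then (if lam = mu then ev (Y id) else 0) else 0)"
      using iff[OF v] ev_Tbarw_Y[OF wlam_in_Sn[OF assms(2,3)]] by auto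
  qed
  also have "\<dots> = (if lam = mu then ev (Y id) else 0)" by simp
  finally show ?thesis .
qed

text \<open>The test runs over all of S_n because the left side is not known beforehand to lie in
  the span of the Grassmannian classes. For w = w_mu u the barred T_u commutes with \<open>f\<close>
  and contributes the same power of p on both sides.\<close>

lemma symmetric_times_Y_lam:
  assumes "k \<le> n" "is_Ahx n f" "block_symmetric n k f"
    and c: "\<And>mu lam v. is_Ahx n (c mu lam v)"
    and exp: "\<And>mu. mu \<in> parts n k \<Longrightarrow> W (wlam n k mu) * M f =
      (\<Sum>(lam, v)\<in>parts n k \<times> young n k. M (c mu lam v) * (W (wlam n k lam) * W v))"
    and P: "\<And>lam mu. is_Ahx n (P lam mu)"
      "\<And>lam mu. M (P lam mu) = (\<Sum>v\<in>young n k. M (c mu lam v) * p ^ plen n v)"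
    and lam: "lam \<in> parts n k"
  shows "act (mp_to_fa f) (Yl k lam) = (\<Sum>mu\<in>parts n k. scale (mp_eval val (P lam mu)) (Yl k mu))"
proof (rule eq_if_ev_Tbarw_eq)
  fix w assume "w \<in> Sn n"
  then obtain mu u where mu: "mu \<in> parts n k" and u: "u \<in> young n k" and w: "w = wlam n k mu \<circ> u"
    using ex_wlam_factorization assms(1) by blast
  let ?Tm = "Tbarw n (wlam n k mu)"
  have Ww: "hecke_class n (Tbarw n w) = hecke_class n (?Tm * Tbarw n u)"
    unfolding w using BF.wprod_comp_young[OF u assms(1) wlam_in_Sn wlam_ascending_lower wlam_ascending_upper] mu assms(1)
    by (simp add: Tbarw_hom mult)
  \<comment> \<open>\<open>P lam mu\<close> is known only through its class; its value at the
    parameters is found by acting on \<open>Y id\<close>, applying \<open>ev\<close> and cancelling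
    the nonzero \<open>ev (Y id)\<close>.\<close>
  have Pev: "mp_eval val (P lam mu) = (\<Sum>v\<in>young n k. mp_eval val (c mu lam v) * pF ^ plen n v)"
  proof -
    have "hecke_class n (mp_to_fa (P lam mu)) = hecke_class n (\<Sum>v\<in>young n k. mp_to_fa (c mu lam v) * fgen Gp ^ plen n v)"
      by (simp add: P(2) hom_simps)
    from act_cong[OF this, of "Y id"]
    have "ev (act (mp_to_fa (P lam mu)) (Y id)) = ev (\<Sum>v\<in>young n k. act (mp_to_fa (c mu lam v)) (scale (pF ^ plen n v) (Y id)))"
      by (simp add: act_sum act_times act_p_power)
    then have "mp_eval val (P lam mu) * ev (Y id) = (\<Sum>v\<in>young n k. mp_eval val (c mu lam v) * pF ^ plen n v) * ev (Y id)"
      by (simp add: ev_sum ev_act_poly[OF P(1)] ev_act_poly[OF c] ev_scale sum_distrib_right mult.assoc)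
    then show ?thesis using ev_Y_id by simp
  qed
  have "hecke_class n (Tbarw n w * mp_to_fa f) = hecke_class n (?Tm * mp_to_fa f * Tbarw n u)"
    using Ww W_commutes_symmetric[OF u assms(1-3)] by (simp add: mult Tbarw_hom mult.assoc)
  also have "\<dots> = hecke_class n ((\<Sum>(lam, v)\<in>parts n k \<times> young n k.
      mp_to_fa (c mu lam v) * (Tbarw n (wlam n k lam) * Tbarw n v)) * Tbarw n u)"
    using exp[OF mu] by (simp add: hom_simps Tbarw_hom case_prod_unfold)
  finally have "act (Tbarw n w * mp_to_fa f) (Yl k lam) = act ((\<Sum>(lam, v)\<in>parts n k \<times> young n k.
      mp_to_fa (c mu lam v) * (Tbarw n (wlam n k lam) * Tbarw n v)) * Tbarw n u) (Yl k lam)"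
    by (rule act_cong)
  then have "act (Tbarw n w) (act (mp_to_fa f) (Yl k lam)) =
      (\<Sum>(la, v)\<in>parts n k \<times> young n k. act (mp_to_fa (c mu la v)) (act (Tbarw n (wlam n k la)) (act (Tbarw n v)
        (act (Tbarw n u) (Yl k lam)))))"
    by (simp add: act_times act_sum case_prod_unfold)
  then have "ev (act (Tbarw n w) (act (mp_to_fa f) (Yl k lam))) = ev (\<Sum>(la, v)\<in>parts n k \<times> young n k.
      act (mp_to_fa (c mu la v)) (act (Tbarw n (wlam n k la)) (act (Tbarw n v) (act (Tbarw n u) (Yl k lam)))))"
    by (rule arg_cong)
  also have "\<dots> = (\<Sum>la\<in>parts n k. \<Sum>v\<in>young n k. mp_eval val (c mu la v) *
      (pF ^ plen n v * (pF ^ plen n u * (if lam = la then ev (Y id) else 0))))"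
    unfolding ev_sum sum.cartesian_product using lam u assms(1)
    by (intro sum.cong) (auto simp: act_Tbarw_Y_lam act_scale ev_scale ev_act_poly[OF c] ev_Tbarw_Y_lam mult_ac)
  also have "\<dots> = (\<Sum>la\<in>parts n k. if lam = la then
      (\<Sum>v\<in>young n k. mp_eval val (c mu la v) * (pF ^ plen n v * (pF ^ plen n u * ev (Y id)))) else 0)"
    by (intro sum.cong) auto
  also have "\<dots> = (\<Sum>v\<in>young n k. mp_eval val (c mu lam v) * (pF ^ plen n v * (pF ^ plen n u * ev (Y id))))"
    using lam by simp
  also have "\<dots> = pF ^ plen n u * (mp_eval val (P lam mu) * ev (Y id))"
    by (simp add: Pev sum_distrib_left sum_distrib_right mult_ac)
  finally have L: "ev (act (Tbarw n w) (act (mp_to_fa f) (Yl k lam))) = pF ^ plen n u * (mp_eval val (P lam mu) * ev (Y id))" .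
  have "act (Tbarw n w) (Yl k nu) = scale (pF ^ plen n u) (act ?Tm (Yl k nu))" if "nu \<in> parts n k" for nu
    using act_cong[OF Ww] act_Tbarw_Y_lam[OF that u assms(1)] by (simp add: act_times act_scale)
  then have "ev (act (Tbarw n w) (\<Sum>nu\<in>parts n k. scale (mp_eval val (P lam nu)) (Yl k nu))) =
      (\<Sum>nu\<in>parts n k. if nu = mu then mp_eval val (P lam nu) * (pF ^ plen n u * ev (Y id)) else 0)"
    unfolding act_sum_right ev_sum using mu assms(1)
    by (intro sum.cong) (auto simp: act_scale ev_scale ev_Tbarw_Y_lam)
  also have "\<dots> = pF ^ plen n u * (mp_eval val (P lam mu) * ev (Y id))" using mu by simp
  finally show "ev (act (Tbarw n w) (act (mp_to_fa f) (Yl k lam))) =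
      ev (act (Tbarw n w) (\<Sum>mu\<in>parts n k. scale (mp_eval val (P lam mu)) (Yl k mu)))"
    using L by simp
qed

end

theorem theorem4p5:
  fixes n k :: nat and f :: mpoly
  assumes "k \<le> n" and "is_Ahx n f" and "block_symmetric n k f"
  shows "\<exists>P :: nat list \<Rightarrow> nat list \<Rightarrow> mpoly.
     (\<forall>lam mu. is_Ahx n (P lam mu))
   \<and> (\<forall>mu\<in>parts n k. heq (hrel_loc n k)
         (fmul (Tbar_lam n k mu) (mp_to_fa f))
         (\<Sum>lam\<in>parts n k. fmul (mp_to_fa (P lam mu)) (Tbar_lam n k lam)))
   \<and> (\<forall>(scale :: 'f::field_char_0 \<Rightarrow> 'v::ab_group_add \<Rightarrow> 'v) pF qF hF t Top Xop Y ev.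
        schubert_rep n scale pF qF hF t Top Xop Y ev \<longrightarrow>
        (\<forall>lam\<in>parts n k.
           vact n scale pF qF hF Top Xop (mp_to_fa f) (Y_lam n k scale pF Y lam)
           = (\<Sum>mu\<in>parts n k. scale (mp_eval (eval_val pF qF hF t) (P lam mu)) (Y_lam n k scale pF Y mu))))"
proof -
  interpret hecke_hom n "hecke_class n" by (rule hecke_hom_hecke_class)
  have f: "M f \<in> polys" using assms(2) by (simp add: polys_def)
  \<comment> \<open>Quantified over all mu, with zero coefficients outside \<open>parts n k\<close>,
    because \<open>P\<close> has to consist of polynomials at every pair of indices.\<close>
  have "\<forall>mu. \<exists>c. (\<forall>lam v. is_Ahx n (c lam v)) \<and> (mu \<in> parts n k \<longrightarrow> W (wlam n k mu) * M f =
      (\<Sum>(lam, v)\<in>parts n k \<times> young n k. M (c lam v) * (W (wlam n k lam) * W v)))"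
  proof
    fix mu
    show "\<exists>c. (\<forall>lam v. is_Ahx n (c lam v)) \<and> (mu \<in> parts n k \<longrightarrow> W (wlam n k mu) * M f =
      (\<Sum>(lam, v)\<in>parts n k \<times> young n k. M (c lam v) * (W (wlam n k lam) * W v)))"
    proof (cases "mu \<in> parts n k")
      case True
      then show ?thesis using W_times_poly_expansion[OF wlam_in_Sn[OF True assms(1)] f assms(1)] by blast
    next
      case False
      then show ?thesis using is_Ahx_0 by (intro exI[of _ "\<lambda>_ _. 0"]) simp
    qed
  qed
  from choice[OF this] obtain c where c: "\<And>mu lam v. is_Ahx n (c mu lam v)"
    "\<And>mu. mu \<in> parts n k \<Longrightarrow> W (wlam n k mu) * M f =
      (\<Sum>(lam, v)\<in>parts n k \<times> young n k. M (c mu lam v) * (W (wlam n k lam) * W v))"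
    by blast
  have ex: "\<exists>P. is_Ahx n P \<and> M P = (\<Sum>v\<in>young n k. M (c mu lam v) * p ^ plen n v)" for lam mu
  proof -
    have "M (c mu lam v) \<in> polys" for v using c(1) by (simp add: polys_def)
    then have "(\<Sum>v\<in>young n k. M (c mu lam v) * p ^ plen n v) \<in> polys"
      by (intro polys_sum polys_mult polys_power polys_p)
    then obtain P where "(\<Sum>v\<in>young n k. M (c mu lam v) * p ^ plen n v) = M P" "P \<in> {f. is_Ahx n f}"
      unfolding polys_def by (rule imageE)
    then show ?thesis by (intro exI[of _ P]) simp
  qed
  \<comment> \<open>The choice depends on n, k and f alone, so the same \<open>P\<close> serves the
    localized algebra and every representation.\<close>
  define P where "P lam mu = (SOME P. is_Ahx n P \<and> M P = (\<Sum>v\<in>young n k. M (c mu lam v) * p ^ plen n v))" for lam mu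
  have P: "is_Ahx n (P lam mu)" "M (P lam mu) = (\<Sum>v\<in>young n k. M (c mu lam v) * p ^ plen n v)" for lam mu
    using someI_ex[OF ex[of mu lam]] unfolding P_def by blast+
  show ?thesis
  proof (intro exI[of _ P] conjI ballI allI impI)
    show "is_Ahx n (P lam mu)" for lam mu by (rule P(1))
    fix mu assume mu: "mu \<in> parts n k"
    have "hecke_class n (Tbar_lam n k mu * mp_to_fa f) = hecke_class n (\<Sum>lam\<in>parts n k. mp_to_fa (P lam mu) * Tbar_lam n k lam)"
      using Tbar_lam_times_symmetric[OF assms c(2)[OF mu]] by (simp add: hom_simps P(2))
    then have "heq (rels n) (Tbar_lam n k mu * mp_to_fa f) (\<Sum>lam\<in>parts n k. mp_to_fa (P lam mu) * Tbar_lam n k lam)"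
      by (simp only: hecke_class_eq_iff)
    then show "heq (hrel_loc n k) (fmul (Tbar_lam n k mu) (mp_to_fa f))
         (\<Sum>lam\<in>parts n k. fmul (mp_to_fa (P lam mu)) (Tbar_lam n k lam))"
      using fideal_mono[OF rels_subset_hrel_loc] by (simp add: heq_def fmul_eq_times)
  next
    fix scale :: "'f \<Rightarrow> 'v \<Rightarrow> 'v" and pF qF hF t Top Xop Y ev lam
    assume "schubert_rep n scale pF qF hF t Top Xop Y ev" and lam: "lam \<in> parts n k"
    then interpret S: schubert n scale pF qF hF t Top Xop Y ev by unfold_locales
    show "vact n scale pF qF hF Top Xop (mp_to_fa f) (Y_lam n k scale pF Y lam)
       = (\<Sum>mu\<in>parts n k. scale (mp_eval (eval_val pF qF hF t) (P lam mu)) (Y_lam n k scale pF Y mu))"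
      by (rule S.symmetric_times_Y_lam[OF assms c P lam])
  qed
qed

end
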